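(* There are universal constants $c_4,\epsilon_1>0$ and a randomized polynomial-time rounding algorithm such that the following holds. Let $G=(V,E)$ be an $r$-regular graph on $n$ vertices and let $\{\mathbf x_v\}_{v\in V}$ (together with variables $d^{R,b},p^{R,b}$) be a feasible solution of the $k$-th round Sherali-Adams relaxation of ARV, of cost $\mathrm{sdp}$. If there are $2k$ sets $T_1,\dots,T_{2k}\subseteq V$, each of diameter at most $c_4$ with respect to $d^2_{\mathbf x}$, covering at least $(1-\epsilon_1)n$ vertices, then the algorithm finds, with high probability, a cut $S$ ($0<|S|\le n/2$) of expansion $\phi(S)\le O(\mathrm{sdp})$.
   Context: $\phi(S)=|E(S,\bar S)|/(r|S|)$; $d^2_{\mathbf x}(u,v)=\|\mathbf x_u-\mathbf x_v\|^2$, diameter of $T$ is $\max_{u,v\in T}d^2_{\mathbf x}(u,v)$. The $t$-th round Sherali-Adams relaxation of ARV has vector variables $\mathbf x_v$ ($v\in V$), real variables $d^{R,b}(u,v)$ and $p^{R,b}$ for every $R\subseteq V$ with $|R|=t$, every $b:R\to\{0,1\}$ and every $u,v\in V$; its cost is $\frac{1}{2rn}\sum_{(u,v)\in E}\|\mathbf x_u-\mathbf x_v\|^2$ and its constraints are: $\sum_{u,v\in V}\|\mathbf x_u-\mathbf x_v\|^2=n^2$; $\|\mathbf x_u-\mathbf x_v\|^2\le\|\mathbf x_u-\mathbf x_w\|^2+\|\mathbf x_w-\mathbf x_v\|^2$ for all $u,v,w$; for all $R,b$: $\sum_{u,v\in V}d^{R,b}(u,v)=n^2p^{R,b}$ and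 $d^{R,b}(u,v)\le d^{R,b}(u,w)+d^{R,b}(w,v)$ for all $u,v,w$; for all $R$ and $u,v$: $\|\mathbf x_u-\mathbf x_v\|^2=\sum_{b:R\to\{0,1\}}d^{R,b}(u,v)$; for all $R$: $\sum_b p^{R,b}=1$; $p^{R,b}\ge0$; and $d^{R,b}(u,v)=0$ whenever $u,v\in R$ and $b(u)=b(v)$. *)

theory Defs
  imports "HOL-Probability.Probability"
begin

section \<open>Regular graphs, expansion and the Sherali-Adams relaxation of ARV\<close>

text \<open>
  A finite simple graph is given by its vertex set \<open>V\<close> and the symmetric irreflexive set \<open>E\<close>
  of ordered pairs of adjacent vertices: every edge \<open>{u, v}\<close> contributes both \<open>(u, v)\<close> and
  \<open>(v, u)\<close> to \<open>E\<close>.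
\<close>

definition regular_graph :: "'a set \<Rightarrow> ('a \<times> 'a) set \<Rightarrow> nat \<Rightarrow> bool" where
  "regular_graph V E r \<longleftrightarrow>
     finite V \<and> V \<noteq> {} \<and> E \<subseteq> V \<times> V \<and> sym E \<and> irrefl E \<and> (\<forall>v\<in>V. card (E `` {v}) = r)"

text \<open>Each edge between \<open>S\<close> and its complement is counted once, oriented away from \<open>S\<close>.\<close>

definition expansion :: "'a set \<Rightarrow> ('a \<times> 'a) set \<Rightarrow> nat \<Rightarrow> 'a set \<Rightarrow> real" where
  "expansion V E r S = real (card (E \<inter> S \<times> (V - S))) / (real r * real (card S))"

text \<open>
  The vectors \<open>x v\<close> live in \<open>m\<close>-dimensional Euclidean space for a dimension \<open>m\<close> that varies with
  the solution; only the coordinates \<open>x v i\<close> with \<open>i < m\<close> are meaningful.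
\<close>

definition sqdist :: "nat \<Rightarrow> ('a \<Rightarrow> nat \<Rightarrow> real) \<Rightarrow> 'a \<Rightarrow> 'a \<Rightarrow> real" where
  "sqdist m x u v = (\<Sum>i<m. (x u i - x v i)\<^sup>2)"

definition diameter_of :: "('a \<Rightarrow> 'a \<Rightarrow> real) \<Rightarrow> 'a set \<Rightarrow> real" where
  "diameter_of \<delta> T = (if T = {} then 0 else Max {\<delta> u v | u v. u \<in> T \<and> v \<in> T})"

text \<open>
  With both orientations of every edge in \<open>E\<close>, the embedding of a cut \<open>S\<close> (scaled to meet the
  normalisation constraint below) has cost at most the expansion of \<open>S\<close> when
  \<open>2 * card S \<le> card V\<close>, with equality for bisections.
\<close>

definition arv_cost ::
  "'a set \<Rightarrow> ('a \<times> 'a) set \<Rightarrow> nat \<Rightarrow> nat \<Rightarrow> ('a \<Rightarrow> nat \<Rightarrow> real) \<Rightarrow> real" where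
  "arv_cost V E r m x = 1 / (2 * real r * real (card V)) * (\<Sum>(u, v)\<in>E. sqdist m x u v)"

text \<open>
  Assignments \<open>b\<close> from \<open>R\<close> to \<open>{0, 1}\<close> are extensional functions, so that distinct \<open>b\<close> are
  distinct assignments and sums over \<open>b\<close> are finite.
\<close>

definition local_assignments :: "'a set \<Rightarrow> nat \<Rightarrow> ('a set \<times> ('a \<Rightarrow> nat)) set" where
  "local_assignments V t = (SIGMA R : {R. R \<subseteq> V \<and> card R = t}. R \<rightarrow>\<^sub>E {0, 1})"

definition sherali_adams_feasible ::
  "'a set \<Rightarrow> nat \<Rightarrow> nat \<Rightarrow> ('a \<Rightarrow> nat \<Rightarrow> real) \<Rightarrow>
   ('a set \<Rightarrow> ('a \<Rightarrow> nat) \<Rightarrow> 'a \<Rightarrow> 'a \<Rightarrow> real) \<Rightarrow> ('a set \<Rightarrow> ('a \<Rightarrow> nat) \<Rightarrow> real) \<Rightarrow> bool" where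
  "sherali_adams_feasible V t m x d p \<longleftrightarrow>
     (\<Sum>u\<in>V. \<Sum>v\<in>V. sqdist m x u v) = (real (card V))\<^sup>2 \<and>
     (\<forall>u\<in>V. \<forall>v\<in>V. \<forall>w\<in>V. sqdist m x u v \<le> sqdist m x u w + sqdist m x w v) \<and>
     (\<forall>(R, b)\<in>local_assignments V t.
        (\<Sum>u\<in>V. \<Sum>v\<in>V. d R b u v) = (real (card V))\<^sup>2 * p R b \<and>
        (\<forall>u\<in>V. \<forall>v\<in>V. \<forall>w\<in>V. d R b u v \<le> d R b u w + d R b w v) \<and>
        p R b \<ge> 0 \<and>
        (\<forall>u\<in>R. \<forall>v\<in>R. b u = b v \<longrightarrow> d R b u v = 0)) \<and>
     (\<forall>R. R \<subseteq> V \<and> card R = t \<longrightarrow>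
        (\<forall>u\<in>V. \<forall>v\<in>V. sqdist m x u v = (\<Sum>b\<in>R \<rightarrow>\<^sub>E {0, 1}. d R b u v)) \<and>
        (\<Sum>b\<in>R \<rightarrow>\<^sub>E {0, 1}. p R b) = 1)"


section \<open>Randomized algorithms with real inputs\<close>

text \<open>
  Solutions of the relaxation are tuples of arbitrary reals, so algorithms are programs of a
  randomized real random access machine. It has a read-only input, consisting of a list of
  natural numbers and a list of reals, and an infinite work memory of integer cells and one of
  real cells, both with indirect addressing and initially zero.

  Every step costs one unit. The arithmetic is linear on purpose: without products of two
  variables (and without rounding reals to integers) the bit length of all numbers grows by at
  most an additive constant per step, so that on rational inputs a polynomial number of unit
  cost steps is polynomial time in the bit model. Reals can only be compared, added, subtracted
  and scaled by rational constants of the program.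
\<close>

type_synonym input = "nat list \<times> real list"
type_synonym memory = "(nat \<Rightarrow> nat) \<times> (nat \<Rightarrow> real)"

definition input_size :: "input \<Rightarrow> nat" where
  "input_size inp = length (fst inp) + length (snd inp)"

text \<open>\<open>NInput a\<close> and \<open>RInput a\<close> read the input at the position given by the value of \<open>a\<close>,
  \<open>NMem a\<close> and \<open>RMem a\<close> read the work memory at the address given by the value of \<open>a\<close>.
  \<open>NSub\<close> is truncated subtraction.\<close>

datatype nexp =
    NConst nat
  | NInput nexp
  | NMem nexp
  | NAdd nexp nexp
  | NSub nexp nexp

datatype rexp =
    RConst rat
  | RInput nexp
  | RMem nexp
  | RAdd rexp rexp
  | RSub rexp rexp
  | RScale rat rexp

datatype bexp =
    NLess nexp nexp
  | RLess rexp rexp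
  | BNot bexp
  | BAnd bexp bexp

text \<open>\<open>NAssign a e\<close>, \<open>RAssign a e\<close> and \<open>Flip a\<close> write to the cell whose address is the value of
  \<open>a\<close>; \<open>Flip\<close> writes the outcome of a fresh fair coin to an integer cell.\<close>

datatype com =
    Skip
  | NAssign nexp nexp
  | RAssign nexp rexp
  | Flip nexp
  | Seq com com
  | If bexp com com
  | While bexp com

primrec nval :: "input \<Rightarrow> memory \<Rightarrow> nexp \<Rightarrow> nat" where
  "nval inp s (NConst c) = c"
| "nval inp s (NInput a) =
     (let i = nval inp s a in if i < length (fst inp) then fst inp ! i else 0)"
| "nval inp s (NMem a) = fst s (nval inp s a)"
| "nval inp s (NAdd a b) = nval inp s a + nval inp s b"
| "nval inp s (NSub a b) = nval inp s a - nval inp s b"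

primrec rval :: "input \<Rightarrow> memory \<Rightarrow> rexp \<Rightarrow> real" where
  "rval inp s (RConst c) = of_rat c"
| "rval inp s (RInput a) =
     (let i = nval inp s a in if i < length (snd inp) then snd inp ! i else 0)"
| "rval inp s (RMem a) = snd s (nval inp s a)"
| "rval inp s (RAdd a b) = rval inp s a + rval inp s b"
| "rval inp s (RSub a b) = rval inp s a - rval inp s b"
| "rval inp s (RScale c a) = of_rat c * rval inp s a"

primrec bval :: "input \<Rightarrow> memory \<Rightarrow> bexp \<Rightarrow> bool" where
  "bval inp s (NLess a b) \<longleftrightarrow> nval inp s a < nval inp s b"
| "bval inp s (RLess a b) \<longleftrightarrow> rval inp s a < rval inp s b"
| "bval inp s (BNot a) \<longleftrightarrow> \<not> bval inp s a"
| "bval inp s (BAnd a b) \<longleftrightarrow> bval inp s a \<and> bval inp s b"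

text \<open>A configuration is a stack of commands still to be executed and a memory. It is halted
  when the stack is empty.\<close>

type_synonym config = "com list \<times> memory"

primrec step_com :: "input \<Rightarrow> com list \<Rightarrow> memory \<Rightarrow> com \<Rightarrow> config pmf" where
  "step_com inp cs s Skip = return_pmf (cs, s)"
| "step_com inp cs s (NAssign a e) =
     return_pmf (cs, ((fst s)(nval inp s a := nval inp s e), snd s))"
| "step_com inp cs s (RAssign a e) =
     return_pmf (cs, (fst s, (snd s)(nval inp s a := rval inp s e)))"
| "step_com inp cs s (Flip a) =
     map_pmf (\<lambda>c. (cs, ((fst s)(nval inp s a := (if c then 1 else 0)), snd s)))
       (bernoulli_pmf (1 / 2))"
| "step_com inp cs s (Seq P Q) = return_pmf (P # Q # cs, s)"
| "step_com inp cs s (If c P Q) = return_pmf ((if bval inp s c then P else Q) # cs, s)"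
| "step_com inp cs s (While c P) =
     return_pmf (if bval inp s c then P # While c P # cs else cs, s)"

definition step :: "input \<Rightarrow> config \<Rightarrow> config pmf" where
  "step inp cf = (case cf of
      ([], s) \<Rightarrow> return_pmf ([], s)
    | (P # cs, s) \<Rightarrow> step_com inp cs s P)"

primrec run :: "com \<Rightarrow> input \<Rightarrow> nat \<Rightarrow> config pmf" where
  "run P inp 0 = return_pmf ([P], (\<lambda>_. 0, \<lambda>_. 0))"
| "run P inp (Suc t) = bind_pmf (run P inp t) (step inp)"

definition halts_within :: "com \<Rightarrow> input \<Rightarrow> nat \<Rightarrow> bool" where
  "halts_within P inp t \<longleftrightarrow> (\<forall>cf\<in>set_pmf (run P inp t). fst cf = [])"

text \<open>Worst case over the coin flips: every computation path halts within the bound.\<close>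

definition polynomial_time :: "com \<Rightarrow> input set \<Rightarrow> bool" where
  "polynomial_time P I \<longleftrightarrow> (\<exists>a. \<forall>inp\<in>I. halts_within P inp (a + input_size inp ^ a))"

text \<open>The distribution of the final memory. It is only meaningful if \<open>P\<close> halts on \<open>inp\<close> within
  some bounded time; halted configurations do not change any more, so every such bound would
  give the same distribution.\<close>

definition final_memory :: "com \<Rightarrow> input \<Rightarrow> memory pmf" where
  "final_memory P inp = map_pmf snd (run P inp (LEAST t. halts_within P inp t))"


section \<open>Inputs and outputs of rounding algorithms\<close>

text \<open>
  The vertex set of an input graph is \<open>{..<n}\<close>. The pairs \<open>(R, b)\<close> indexing the variables of the
  \<open>k\<close>-th round relaxation are presented in an arbitrary order \<open>L\<close>. An input lists \<open>n\<close>, \<open>r\<close>, \<open>k\<close>,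
  the dimension \<open>m\<close>, the number of pairs, the adjacency matrix and, for every pair \<open>(R, b)\<close> of
  \<open>L\<close>, a row of \<open>n\<close> entries where \<open>v\<close> is marked 0 if it is not in \<open>R\<close>, and \<open>1 + b v\<close> otherwise;
  then, as real numbers, the values of all variables. For the inputs considered below every
  integer entry is bounded by the number of entries of the input (or by a constant), which makes
  the number of entries an adequate measure of its size.
\<close>

definition encode ::
  "nat \<Rightarrow> (nat \<times> nat) set \<Rightarrow> nat \<Rightarrow> nat \<Rightarrow> (nat set \<times> (nat \<Rightarrow> nat)) list \<Rightarrow> nat \<Rightarrow>
   (nat \<Rightarrow> nat \<Rightarrow> real) \<Rightarrow> (nat set \<Rightarrow> (nat \<Rightarrow> nat) \<Rightarrow> nat \<Rightarrow> nat \<Rightarrow> real) \<Rightarrow>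
   (nat set \<Rightarrow> (nat \<Rightarrow> nat) \<Rightarrow> real) \<Rightarrow> input" where
  "encode n E r k L m x d p =
     ([n, r, k, m, length L]
        @ [if (u, v) \<in> E then 1 else 0. u \<leftarrow> [0..<n], v \<leftarrow> [0..<n]]
        @ [if v \<in> R then 1 + b v else 0. (R, b) \<leftarrow> L, v \<leftarrow> [0..<n]],
      [x v i. v \<leftarrow> [0..<n], i \<leftarrow> [0..<m]]
        @ [p R b. (R, b) \<leftarrow> L]
        @ [d R b u v. (R, b) \<leftarrow> L, u \<leftarrow> [0..<n], v \<leftarrow> [0..<n]])"

text \<open>The expansion has \<open>r\<close> in its denominator, hence \<open>r > 0\<close>. There are sets \<open>R\<close> of \<open>k\<close> vertices
  only if \<open>k \<le> n\<close>; for larger \<open>k\<close> the relaxation would have no variables indexed by \<open>(R, b)\<close>.\<close>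

definition rounding_instance ::
  "nat \<Rightarrow> (nat \<times> nat) set \<Rightarrow> nat \<Rightarrow> nat \<Rightarrow> (nat set \<times> (nat \<Rightarrow> nat)) list \<Rightarrow> bool" where
  "rounding_instance n E r k L \<longleftrightarrow>
     regular_graph {..<n} E r \<and> r > 0 \<and> k \<le> n \<and>
     distinct L \<and> set L = local_assignments {..<n} k"

definition rounding_inputs :: "input set" where
  "rounding_inputs = {encode n E r k L m x d p | n E r k L m x d p. rounding_instance n E r k L}"

definition output_set :: "nat \<Rightarrow> memory \<Rightarrow> nat set" where
  "output_set n s = {v. v < n \<and> fst s v = 1}"

end

theory Submission
  imports Defs
begin

text \<open>
  The rounding algorithm is deterministic: for every \<open>(R, b)\<close> and every vertex \<open>w\<close> it tries all
  sweep cuts of the function \<open>f v = d R b v w + d R b w v\<close> and keeps the sparsest one.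

  One of these cuts is good. Half of the \<open>2 * k\<close> sets cover a quarter of the vertices. Let \<open>R\<close>
  contain a representative of each of these \<open>k\<close> sets. For every \<open>b\<close>, all representatives with the
  same value of \<open>b\<close> are at distance 0 under \<open>d R b\<close>, so for one of the two values, an eighth of the
  vertices lies in sets whose representatives are merged into a single point \<open>w\<close>. Averaging over
  \<open>b\<close> gives a \<open>b\<close> with \<open>p R b > 0\<close> for which those vertices are on average close to \<open>w\<close> and for
  which the edges are short in terms of \<open>sdp * p R b\<close>. As the average of \<open>d R b\<close> over all pairs is
  \<open>p R b\<close>, the average of \<open>f\<close> is of that order, so \<open>f\<close> spreads by a constant times
  \<open>n\<^sup>2 * p R b\<close>. Integrating over the threshold yields a sweep cut of expansion \<open>O(sdp)\<close>.
\<close>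

section \<open>Execution of coin-free programs\<close>

text \<open>Every step is required to be a point mass, so the execution of a coin-free program is an
  ordinary relation and probability only returns with \<open>final_memory\<close>.\<close>

primrec reaches :: "input \<Rightarrow> nat \<Rightarrow> config \<Rightarrow> config \<Rightarrow> bool" where
  "reaches inp 0 cf cf' \<longleftrightarrow> cf' = cf"
| "reaches inp (Suc t) cf cf' \<longleftrightarrow> (\<exists>cf1. step inp cf = return_pmf cf1 \<and> reaches inp t cf1 cf')"

lemma reaches_trans:
  "reaches inp t a b \<Longrightarrow> reaches inp t' b c \<Longrightarrow> reaches inp (t + t') a c"
  by (induction t arbitrary: a) auto

lemma run_reaches:
  "run P inp t0 = return_pmf a \<Longrightarrow> reaches inp t a b \<Longrightarrow> run P inp (t0 + t) = return_pmf b"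
proof (induction t arbitrary: a t0)
  case (Suc t)
  then obtain c where c: "step inp a = return_pmf c" "reaches inp t c b" by auto
  have "run P inp (Suc t0) = return_pmf c"
    using Suc.prems(1) c(1) by (simp add: bind_return_pmf)
  from Suc.IH[OF this c(2)] show ?case by simp
qed simp

text \<open>On the support of a halted run, \<open>step\<close> coincides with
  \<open>return_pmf\<close>, so binding it changes nothing.\<close>

lemma run_halted:
  assumes "halts_within P inp t"
  shows "run P inp (t + j) = run P inp t"
proof (induction j)
  case (Suc j)
  have "bind_pmf (run P inp t) (step inp) = bind_pmf (run P inp t) return_pmf"
    using assms by (intro bind_pmf_cong) (auto simp: halts_within_def step_def split: prod.splits list.splits)
  then show ?case using Suc by (simp add: bind_return_pmf')
qed simp

lemma halts_within_mono:
  assumes "halts_within P inp t" "t \<le> t'"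
  shows "halts_within P inp t'"
  using assms run_halted[OF assms(1), of "t' - t"] by (simp add: halts_within_def)

lemma final_memory_eqI:
  assumes "run P inp t = return_pmf ([], s)"
  shows "final_memory P inp = return_pmf s"
proof -
  define t0 where "t0 = (LEAST t. halts_within P inp t)"
  have h: "halts_within P inp t" using assms by (simp add: halts_within_def)
  have "halts_within P inp t0" "t0 \<le> t"
    unfolding t0_def using h by (auto intro: LeastI Least_le)
  then have "run P inp t = run P inp t0"
    using run_halted[of P inp t0 "t - t0"] by simp
  then show ?thesis
    unfolding final_memory_def t0_def[symmetric] using assms by (metis map_return_pmf snd_conv)
qed

section \<open>Step bounds that are polynomial in the loop bound\<close>

text \<open>This is an upper bound: \<open>If\<close> pays for both branches. In
  \<open>While\<close>, the inner \<open>Suc\<close> pays for a successful test and the outer one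
  for the final failing test.\<close>

primrec cost :: "nat \<Rightarrow> com \<Rightarrow> nat" where
  "cost z Skip = 1"
| "cost z (NAssign a e) = 1"
| "cost z (RAssign a e) = 1"
| "cost z (Flip a) = 1"
| "cost z (Seq P Q) = Suc (cost z P + cost z Q)"
| "cost z (If c P Q) = Suc (cost z P + cost z Q)"
| "cost z (While c P) = Suc (z * Suc (cost z P))"

text \<open>Both powers are at most \<open>y ^ (a + b)\<close>, and a base of at least 2 absorbs the
  factor 2. Bounds by powers are thus closed under sums.\<close>

lemma power_add_le_power_Suc:
  fixes y :: nat
  assumes "2 \<le> y"
  shows "y ^ a + y ^ b \<le> y ^ Suc (a + b)"
proof -
  have "y ^ a \<le> y ^ (a + b)" "y ^ b \<le> y ^ (a + b)"
    using assms by (auto intro: power_increasing)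
  moreover have "2 * y ^ (a + b) \<le> y * y ^ (a + b)" using assms by (rule mult_le_mono1)
  ultimately show ?thesis unfolding power_Suc by linarith
qed

lemma cost_le_power: "\<exists>a. \<forall>z. cost z P \<le> (z + 2) ^ a"
proof (induction P)
  case (Seq P Q)
  then obtain a b where ab: "\<And>z. cost z P \<le> (z + 2) ^ a" "\<And>z. cost z Q \<le> (z + 2) ^ b" by blast
  \<comment> \<open>The summand 0 in the exponent comes from writing the additional step as the
    power \<open>(z + 2) ^ 0\<close>. The same happens in the other cases.\<close>
  have "cost z (Seq P Q) \<le> (z + 2) ^ Suc (Suc (a + b) + 0)" for z
    using ab(1,2)[of z] power_add_le_power_Suc[of "z + 2" a b]
      power_add_le_power_Suc[of "z + 2" "Suc (a + b)" 0] by simp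
  then show ?case by blast
next
  case (If c P Q)
  then obtain a b where ab: "\<And>z. cost z P \<le> (z + 2) ^ a" "\<And>z. cost z Q \<le> (z + 2) ^ b" by blast
  have "cost z (If c P Q) \<le> (z + 2) ^ Suc (Suc (a + b) + 0)" for z
    using ab(1,2)[of z] power_add_le_power_Suc[of "z + 2" a b]
      power_add_le_power_Suc[of "z + 2" "Suc (a + b)" 0] by simp
  then show ?case by blast
next
  case (While c P)
  then obtain a where a: "\<And>z. cost z P \<le> (z + 2) ^ a" by blast
  have "cost z (While c P) \<le> (z + 2) ^ Suc (Suc (Suc (a + 0)) + 0)" for z
  proof -
    have "Suc (cost z P) \<le> (z + 2) ^ Suc (a + 0)"
      using a[of z] power_add_le_power_Suc[of "z + 2" a 0] by simp
    then have "z * Suc (cost z P) \<le> (z + 2) * (z + 2) ^ Suc (a + 0)"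
      by (intro mult_le_mono) auto
    then show ?thesis
      using power_add_le_power_Suc[of "z + 2" "Suc (Suc (a + 0))" 0] by simp
  qed
  then show ?case by blast
qed (auto intro!: exI[of _ 0])

lemma cost_polynomial: "\<exists>a. \<forall>z. cost z P \<le> a + z ^ a"
proof -
  obtain a where a: "\<And>z. cost z P \<le> (z + 2) ^ a" using cost_le_power by blast
  \<comment> \<open>\<open>polynomial_time\<close> uses one number both as additive constant and as
    exponent. Here \<open>3 ^ a\<close> serves \<open>z < 2\<close>, and \<open>2 * a\<close> serves
    larger \<open>z\<close>, where \<open>z + 2 \<le> z ^ 2\<close>.\<close>
  have "(z + 2) ^ a \<le> (2 * a + 3 ^ a) + z ^ (2 * a + 3 ^ a)" for z :: nat
  proof (cases "z < 2")
    case True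
    then have "(z + 2) ^ a \<le> 3 ^ a" by (intro power_mono) auto
    then show ?thesis by simp
  next
    case False
    then have "z + 2 \<le> z ^ 2"
      using mult_le_mono1[of 2 z z] unfolding power2_eq_square by linarith
    then have "(z + 2) ^ a \<le> (z ^ 2) ^ a" by (intro power_mono) auto
    also have "\<dots> \<le> z ^ (2 * a + 3 ^ a)"
      unfolding power_mult[symmetric] using False by (intro power_increasing) auto
    finally show ?thesis by simp
  qed
  then show ?thesis using a by (meson le_trans)
qed

text \<open>In \<open>cost\<close> and \<open>wp\<close>, \<open>z\<close> bounds the number of iterations of every single loop, so a
  program of fixed loop depth has polynomial cost in \<open>z\<close>.\<close>

definition wp :: "input \<Rightarrow> nat \<Rightarrow> com \<Rightarrow> (memory \<Rightarrow> bool) \<Rightarrow> memory \<Rightarrow> bool" where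
  "wp inp z P Q s \<longleftrightarrow>
     (\<exists>t s'. t \<le> cost z P \<and> Q s' \<and> (\<forall>cs. reaches inp t (P # cs, s) (cs, s')))"

text \<open>The arbitrary remaining stack in \<open>wp\<close> is specialised to the empty one,
  which turns a \<open>wp\<close> fact about the initial memory into a point mass for the final
  memory.\<close>

lemma wp_run:
  assumes "wp inp z P Q (\<lambda>_. 0, \<lambda>_. 0)"
  obtains s where "Q s" "final_memory P inp = return_pmf s" "halts_within P inp (cost z P)"
proof -
  obtain t s where ts: "t \<le> cost z P" "Q s"
    "reaches inp t ([P], (\<lambda>_. 0, \<lambda>_. 0)) ([], s)"
    using assms unfolding wp_def by blast
  then have run: "run P inp t = return_pmf ([], s)"
    using run_reaches[of P inp 0 _ t] by simp
  then have "halts_within P inp t" by (simp add: halts_within_def)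
  with that[OF ts(2) final_memory_eqI[OF run]] ts(1) show thesis
    using halts_within_mono by blast
qed

section \<open>Proof rules for the commands\<close>

lemma wp_Skip: "Q s \<Longrightarrow> wp inp z Skip Q s"
  unfolding wp_def
  by (rule exI[of _ 1], rule exI, rule conjI, simp, rule conjI, assumption) (simp add: step_def)

lemma wp_NAssign:
  "Q ((fst s)(nval inp s a := nval inp s e), snd s) \<Longrightarrow> wp inp z (NAssign a e) Q s"
  unfolding wp_def
  by (rule exI[of _ 1], rule exI, rule conjI, simp, rule conjI, assumption) (simp add: step_def)

lemma wp_RAssign:
  "Q (fst s, (snd s)(nval inp s a := rval inp s e)) \<Longrightarrow> wp inp z (RAssign a e) Q s"
  unfolding wp_def
  by (rule exI[of _ 1], rule exI, rule conjI, simp, rule conjI, assumption) (simp add: step_def)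

lemma wp_Seq:
  assumes "wp inp z P (wp inp z Q R) s"
  shows "wp inp z (Seq P Q) R s"
proof -
  obtain t1 s1 where 1: "t1 \<le> cost z P" "wp inp z Q R s1"
    "\<And>cs. reaches inp t1 (P # cs, s) (cs, s1)" using assms unfolding wp_def[of _ _ P] by blast
  then obtain t2 s2 where 2: "t2 \<le> cost z Q" "R s2"
    "\<And>cs. reaches inp t2 (Q # cs, s1) (cs, s2)" unfolding wp_def by blast
  have "reaches inp (Suc (t1 + t2)) (Seq P Q # cs, s) (cs, s2)" for cs
    using reaches_trans[OF 1(3) 2(3)] by (simp add: step_def)
  then show ?thesis unfolding wp_def using 1 2
    by (intro exI[of _ "Suc (t1 + t2)"] exI[of _ s2]) auto
qed

lemma wp_If:
  assumes "bval inp s c \<Longrightarrow> wp inp z P R s" "\<not> bval inp s c \<Longrightarrow> wp inp z Q R s"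
  shows "wp inp z (If c P Q) R s"
proof -
  have "\<exists>t s'. t \<le> cost z P + cost z Q \<and> R s' \<and>
      (\<forall>cs. reaches inp t ((if bval inp s c then P else Q) # cs, s) (cs, s'))"
    using assms unfolding wp_def by (cases "bval inp s c") (auto intro: trans_le_add1 trans_le_add2)
  then obtain t s' where "t \<le> cost z P + cost z Q" "R s'"
      "\<forall>cs. reaches inp t ((if bval inp s c then P else Q) # cs, s) (cs, s')" by blast
  then show ?thesis unfolding wp_def
    by (intro exI[of _ "Suc t"] exI[of _ s']) (auto simp: step_def)
qed

lemma wp_mono: "wp inp z P Q s \<Longrightarrow> (\<And>s. Q s \<Longrightarrow> R s) \<Longrightarrow> wp inp z P R s"
  unfolding wp_def by blast

text \<open>The invariant is indexed by the number of completed iterations and decides the guard, so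
  exactly \<open>N\<close> iterations take place and no separate termination measure arises.\<close>

lemma wp_While:
  assumes "N \<le> z" "I 0 s"
    and body: "\<And>j s. j < N \<Longrightarrow> I j s \<Longrightarrow> bval inp s c \<and> wp inp z P (I (Suc j)) s"
    and exit: "\<And>s. I N s \<Longrightarrow> \<not> bval inp s c \<and> Q s"
  shows "wp inp z (While c P) Q s"
proof -
  \<comment> \<open>The induction is on the number \<open>i\<close> of iterations still to
    come.\<close>
  have "\<exists>t s'. t \<le> Suc (i * Suc (cost z P)) \<and> Q s' \<and>
      (\<forall>cs. reaches inp t (While c P # cs, s) (cs, s'))" if "I (N - i) s" "i \<le> N" for i s
    using that
  proof (induction i arbitrary: s)
    case 0
    then have "\<not> bval inp s c \<and> Q s" using exit by simp
    then show ?case by (intro exI[of _ 1] exI[of _ s]) (auto simp: step_def)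
  next
    case (Suc i)
    have "Suc (N - Suc i) = N - i" using Suc.prems(2) by simp
    then have c: "bval inp s c" and "wp inp z P (I (N - i)) s"
      using body[of "N - Suc i" s] Suc.prems by auto
    then obtain t1 s1 where 1: "t1 \<le> cost z P" "I (N - i) s1"
      "\<And>cs. reaches inp t1 (P # cs, s) (cs, s1)" unfolding wp_def by blast
    obtain t2 s2 where 2: "t2 \<le> Suc (i * Suc (cost z P))" "Q s2"
      "\<And>cs. reaches inp t2 (While c P # cs, s1) (cs, s2)"
      using Suc.IH[OF 1(2)] Suc.prems(2) by auto
    have "reaches inp (Suc (t1 + t2)) (While c P # cs, s) (cs, s2)" for cs
      using reaches_trans[OF 1(3) 2(3)] c by (simp add: step_def)
    then show ?case using 1 2 by (intro exI[of _ "Suc (t1 + t2)"] exI[of _ s2]) auto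
  qed
  from this[of N s] assms(2) obtain t s' where "t \<le> Suc (N * Suc (cost z P))" "Q s'"
      "\<forall>cs. reaches inp t (While c P # cs, s) (cs, s')" by auto
  moreover have "N * Suc (cost z P) \<le> z * Suc (cost z P)" using assms(1) by (rule mult_le_mono1)
  ultimately show ?thesis
    unfolding wp_def by (metis cost.simps(7) Suc_le_mono le_trans)
qed

section \<open>The sweep-cut program\<close>

text \<open>The cells \<open>0, \<dots>, n - 1\<close> are reserved for the output, so variable number \<open>i\<close> lives in cell
  \<open>n + i\<close>. The first integer of the input is \<open>n\<close>.\<close>

abbreviation "inN \<equiv> NInput (NConst 0)"
abbreviation "addr i \<equiv> NAdd inN (NConst i)"
abbreviation "var i \<equiv> NMem (addr i)"
abbreviation "setv i e \<equiv> NAssign (addr i) e"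

definition For :: "nat \<Rightarrow> nexp \<Rightarrow> com \<Rightarrow> com" where
  "For i b P = Seq (setv i (NConst 0))
     (While (NLess (var i) b) (Seq P (setv i (NAdd (var i) (NConst 1)))))"

text \<open>The machine has no products of variables, so multiplication is repeated addition; its
  first factor is a loop count.\<close>

definition Mul :: "nat \<Rightarrow> nexp \<Rightarrow> nexp \<Rightarrow> com" where
  "Mul t a b = Seq (setv t (NConst 0)) (For 5 a (setv t (NAdd (var t) b)))"

text \<open>Integer variables: 0 row \<open>l\<close> of the input, 1 centre \<open>w\<close>, 2 vertex \<open>v\<close>, 3 threshold vertex
  \<open>u\<close>, 4 vertex \<open>y\<close>, 5 counter of \<open>Mul\<close>, 6 \<open>n * n\<close>, 7 \<open>n * m\<close>, 8 \<open>l * n * n\<close>, 9 \<open>w * n\<close>,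
  10 \<open>v * n\<close>, 11 and 12 size and number of leaving edges of the current cut, 13 and 14 products
  to be compared, 15 and 16 number of leaving edges and size of the best cut so far, from 17 on
  the indicator function of the current cut. Real cell \<open>v\<close> holds the distance of \<open>v\<close> from \<open>w\<close>.\<close>

definition fill_prog :: com where
  "fill_prog = For 2 inN (Seq (Mul 10 (var 2) inN)
     (RAssign (var 2)
       (RAdd (RInput (NAdd (NAdd (NAdd (var 7) (NInput (NConst 4))) (var 8)) (NAdd (var 10) (var 1))))
             (RInput (NAdd (NAdd (NAdd (var 7) (NInput (NConst 4))) (var 8)) (NAdd (var 9) (var 2)))))))"

text \<open>A sublevel set changes only at values attained by the function, so thresholds at
  vertices give all nonempty sublevel sets. The strict test excludes vertices, which puts ties into
  the set.\<close>

definition mark_prog :: com where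
  "mark_prog = Seq (setv 11 (NConst 0)) (For 2 inN
     (If (RLess (RMem (var 3)) (RMem (var 2)))
        (NAssign (NAdd (addr 17) (var 2)) (NConst 0))
        (Seq (NAssign (NAdd (addr 17) (var 2)) (NConst 1)) (setv 11 (NAdd (var 11) (NConst 1))))))"

definition flip_prog :: com where
  "flip_prog = If (NLess inN (NAdd (var 11) (var 11)))
     (Seq (For 2 inN (NAssign (NAdd (addr 17) (var 2))
            (NSub (NConst 1) (NMem (NAdd (addr 17) (var 2))))))
          (setv 11 (NSub inN (var 11))))
     Skip"

definition cut_prog :: com where
  "cut_prog = Seq (setv 12 (NConst 0)) (For 2 inN (Seq (Mul 10 (var 2) inN) (For 4 inN
     (If (BAnd (BAnd (NLess (NConst 0) (NMem (NAdd (addr 17) (var 2))))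
                     (NLess (NMem (NAdd (addr 17) (var 4))) (NConst 1)))
               (NLess (NConst 0) (NInput (NAdd (NConst 5) (NAdd (var 10) (var 4))))))
        (setv 12 (NAdd (var 12) (NConst 1))) Skip))))"

text \<open>The comparison is strict, so an empty cut, for which both products are 0, is never
  saved.\<close>

definition save_prog :: com where
  "save_prog = Seq (Mul 13 (var 16) (var 12)) (Seq (Mul 14 (var 11) (var 15))
     (If (NLess (var 13) (var 14))
        (Seq (For 2 inN (NAssign (var 2) (NMem (NAdd (addr 17) (var 2)))))
             (Seq (setv 15 (var 12)) (setv 16 (var 11))))
        Skip))"

definition try_prog :: com where
  "try_prog = Seq mark_prog (Seq flip_prog (Seq cut_prog save_prog))"

definition row_prog :: com where
  "row_prog = Seq (Mul 8 (var 0) (var 6)) (For 1 inN (Seq (Mul 9 (var 1) inN)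
     (Seq fill_prog (For 3 inN try_prog))))"

definition sweep_prog :: com where
  "sweep_prog = Seq (setv 15 (NConst 1)) (Seq (Mul 6 inN inN) (Seq (Mul 7 inN (NInput (NConst 3)))
     (For 0 (NInput (NConst 4)) row_prog)))"

section \<open>Preservation of memory cells and access to the input\<close>

text \<open>Only the integer memory is tracked; preservation of the real memory is stated separately
  as \<open>snd s' = snd s\<close>.\<close>

definition frame :: "nat set \<Rightarrow> memory \<Rightarrow> memory \<Rightarrow> bool" where
  "frame M s s' \<longleftrightarrow> (\<forall>a. a \<notin> M \<longrightarrow> fst s' a = fst s a)"

lemma frame_refl [simp]: "frame M s s"
  by (simp add: frame_def)

lemma frameD: "frame M s s' \<Longrightarrow> a \<notin> M \<Longrightarrow> fst s' a = fst s a"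
  by (simp add: frame_def)

lemma frame_trans: "frame M s s' \<Longrightarrow> frame M' s' s'' \<Longrightarrow> M \<subseteq> K \<Longrightarrow> M' \<subseteq> K \<Longrightarrow> frame K s s''"
  unfolding frame_def by (metis subsetD)

lemma frame_upd [simp]: "a \<in> M \<Longrightarrow> frame M s (f(a := x), h) = frame M s (f, h)"
  by (auto simp: frame_def)

lemma frame_fst [simp]: "frame M s (fst s', h) = frame M s s'"
  by (auto simp: frame_def)

text \<open>Hides the bounds check of an input access, so that symbolic execution keeps positions as
  plain arithmetic terms instead of splitting cases.\<close>

definition nin :: "input \<Rightarrow> nat \<Rightarrow> nat" where
  "nin inp i = (if i < length (fst inp) then fst inp ! i else 0)"

definition rin :: "input \<Rightarrow> nat \<Rightarrow> real" where
  "rin inp i = (if i < length (snd inp) then snd inp ! i else 0)"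

lemma nval_NInput: "nval inp s (NInput a) = nin inp (nval inp s a)"
  by (simp add: nin_def Let_def)

lemma rval_RInput: "rval inp s (RInput a) = rin inp (nval inp s a)"
  by (simp add: rin_def Let_def)

declare nval.simps(2) [simp del] rval.simps(2) [simp del] nval_NInput [simp] rval_RInput [simp]

locale machine =
  fixes inp :: input and n z :: nat
  assumes nin_0 [simp]: "nin inp 0 = n" and n_le: "n \<le> z"
begin

text \<open>\<open>J\<close> has to be insensitive to the loop counter, so that resetting and
  incrementing it preserve \<open>J\<close>; the body may use the counter but must end with its
  value intact.\<close>

lemma wp_For:
  assumes N: "N \<le> z" and init: "J 0 s"
    and J: "\<And>j s x. J j s \<Longrightarrow> J j ((fst s)(n + i := x), snd s)"
    and bound: "\<And>j s. J j s \<Longrightarrow> nval inp s b = N"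
    and body: "\<And>j s. j < N \<Longrightarrow> J j s \<Longrightarrow> fst s (n + i) = j \<Longrightarrow>
      wp inp z P (\<lambda>s'. J (Suc j) s' \<and> fst s' (n + i) = j) s"
    and post: "\<And>s. J N s \<Longrightarrow> Q s"
  shows "wp inp z (For i b P) Q s"
  unfolding For_def
  apply (rule wp_Seq, rule wp_NAssign)
  apply (rule wp_While[where N = N and I = "\<lambda>j s. J j s \<and> fst s (n + i) = j", OF N])
  subgoal using J[OF init] by simp
  subgoal for j s
    apply (rule conjI)
     apply (use bound[of j s] in simp)
    apply (rule wp_Seq, rule wp_mono, rule body[of j s])
    using J[of "Suc j"] by (auto intro: wp_NAssign)
  subgoal for s using bound[of N s] post by auto
  done

lemma wp_Mul:
  assumes "t \<noteq> 5" "nval inp s a \<le> z"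
    and a: "\<And>s'. frame {n + t, n + 5} s s' \<Longrightarrow> nval inp s' a = nval inp s a"
    and b: "\<And>s'. frame {n + t, n + 5} s s' \<Longrightarrow> nval inp s' b = nval inp s b"
    and post: "\<And>s'. frame {n + t, n + 5} s s' \<Longrightarrow> snd s' = snd s \<Longrightarrow>
      fst s' (n + t) = nval inp s a * nval inp s b \<Longrightarrow> Q s'"
  shows "wp inp z (Mul t a b) Q s"
  unfolding Mul_def
  apply (rule wp_Seq, rule wp_NAssign)
  apply (rule wp_For[where N = "nval inp s a" and J = "\<lambda>j s'. frame {n + t, n + 5} s s' \<and> snd s' = snd s \<and>
      fst s' (n + t) = j * nval inp s b", OF assms(2)])
  subgoal by simp
  subgoal using assms(1) by simp
  subgoal for j s' using a[of s'] by simp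
  subgoal for j s' using assms(1) b[of s'] by (intro wp_NAssign) simp
  subgoal for s' using post[of s'] by simp
  done


section \<open>Trying a single cut\<close>

definition ind :: "nat set \<Rightarrow> memory \<Rightarrow> bool" where
  "ind S s \<longleftrightarrow> (\<forall>v<n. fst s (n + 17 + v) = (if v \<in> S then 1 else 0))"

definition small_side :: "nat set \<Rightarrow> nat set" where
  "small_side S = (if n < card S + card S then {..<n} - S else S)"

text \<open>The offset 5 skips the integers in front of the adjacency matrix. The count refers to
  the raw input, as the program sees it; \<open>cut_size_encode\<close> translates it to
  edges.\<close>

definition cut_size :: "nat set \<Rightarrow> nat" where
  "cut_size S = (\<Sum>v<n. \<Sum>y<n. if v \<in> S \<and> y \<notin> S \<and> 0 < nin inp (5 + (v * n + y)) then 1 else 0)"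

lemma card_less_Suc: "card {v. v < Suc j \<and> P v} = card {v. v < j \<and> P v} + (if P j then 1 else 0)"
proof -
  have "{v. v < Suc j \<and> P v} = (if P j then insert j {v. v < j \<and> P v} else {v. v < j \<and> P v})"
    by (auto simp: less_Suc_eq)
  then show ?thesis by simp
qed

lemma wp_mark:
  assumes post: "\<And>s'. frame ({n + 2, n + 11} \<union> {n + 17..}) s s' \<Longrightarrow> snd s' = snd s \<Longrightarrow>
      ind {v. v < n \<and> snd s v \<le> snd s (fst s (n + 3))} s' \<Longrightarrow>
      fst s' (n + 11) = card {v. v < n \<and> snd s v \<le> snd s (fst s (n + 3))} \<Longrightarrow> Q s'"
  shows "wp inp z mark_prog Q s"
  unfolding mark_prog_def
  apply (rule wp_Seq, rule wp_NAssign)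
  apply (rule wp_For[where N = n and J = "\<lambda>j s'. frame ({n + 2, n + 11} \<union> {n + 17..}) s s' \<and> snd s' = snd s \<and>
      (\<forall>v<j. fst s' (n + 17 + v) = (if snd s v \<le> snd s (fst s (n + 3)) then 1 else 0)) \<and>
      fst s' (n + 11) = card {v. v < j \<and> snd s v \<le> snd s (fst s (n + 3))}", OF n_le])
  subgoal by simp
  subgoal by auto
  subgoal by simp
  subgoal for j s'
    apply (rule wp_If)
    subgoal by (intro wp_NAssign)
        (auto simp: frameD[where a = "n + 3"] card_less_Suc All_less_Suc)
    subgoal by (intro wp_Seq wp_NAssign)
        (auto simp: frameD[where a = "n + 3"] card_less_Suc All_less_Suc)
    done
  subgoal for s' by (rule post) (auto simp: ind_def)
  done

lemma wp_flip:
  assumes S: "ind S s" "S \<subseteq> {..<n}" "fst s (n + 11) = card S"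
    and post: "\<And>s'. frame ({n + 2, n + 11} \<union> {n + 17..}) s s' \<Longrightarrow> snd s' = snd s \<Longrightarrow>
      ind (small_side S) s' \<Longrightarrow> fst s' (n + 11) = card (small_side S) \<Longrightarrow> Q s'"
  shows "wp inp z flip_prog Q s"
  unfolding flip_prog_def
  apply (rule wp_If)
  subgoal
    apply (rule wp_Seq)
    \<comment> \<open>The indicators of the vertices below \<open>j\<close> are already complemented
      and the others are not; both cases are merged into the equation
      \<open>(v \<in> S) = (v < j)\<close>.\<close>
    apply (rule wp_For[where N = n and J = "\<lambda>j s'. frame ({n + 2, n + 11} \<union> {n + 17..}) s s' \<and> snd s' = snd s \<and>
      (\<forall>v<n. fst s' (n + 17 + v) = (if (v \<in> S) = (v < j) then 0 else 1)) \<and> fst s' (n + 11) = card S", OF n_le])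
    subgoal using S by (auto simp: ind_def)
    subgoal by auto
    subgoal by simp
    subgoal for j s' by (intro wp_NAssign) (auto simp: less_Suc_eq)
    subgoal for s'
      apply (rule wp_NAssign, rule post)
         apply (use S in \<open>auto simp: ind_def small_side_def card_Diff_subset finite_subset\<close>)
      done
    done
  subgoal by (rule wp_Skip, rule post) (use S in \<open>auto simp: small_side_def\<close>)
  done

lemma wp_cut:
  assumes S: "ind S s"
    and post: "\<And>s'. frame {n + 2, n + 4, n + 5, n + 10, n + 12} s s' \<Longrightarrow> snd s' = snd s \<Longrightarrow>
      fst s' (n + 12) = cut_size S \<Longrightarrow> Q s'"
  shows "wp inp z cut_prog Q s"
proof -
  let ?M = "{n + 2, n + 4, n + 5, n + 10, n + 12}"
  let ?c = "\<lambda>v y. if v \<in> S \<and> y \<notin> S \<and> 0 < nin inp (5 + (v * n + y)) then 1 else (0::nat)"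
  have g: "fst s' (n + 17 + v) = (if v \<in> S then 1 else 0)" if "frame ?M s s'" "v < n" for s' v
    using frameD[OF that(1), of "n + 17 + v"] S that(2) by (simp add: ind_def)
  show ?thesis
    unfolding cut_prog_def
    apply (rule wp_Seq, rule wp_NAssign)
    apply (rule wp_For[where N = n and J = "\<lambda>j s'. frame ?M s s' \<and> snd s' = snd s \<and>
      fst s' (n + 12) = (\<Sum>v<j. \<Sum>y<n. ?c v y)", OF n_le])
    subgoal by simp
    subgoal by simp
    subgoal by simp
    subgoal for j s1
      apply (rule wp_Seq, rule wp_Mul)
      subgoal by simp
      subgoal using n_le by simp
      subgoal by (simp add: frame_def)
      subgoal by (simp add: frame_def)
      subgoal for s2
        apply (rule wp_For[where N = n and J = "\<lambda>i s'. frame ?M s s' \<and> snd s' = snd s \<and> fst s' (n + 2) = j \<and>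
          fst s' (n + 10) = j * n \<and> fst s' (n + 12) = (\<Sum>v<j. \<Sum>y<n. ?c v y) + (\<Sum>y<i. ?c j y)", OF n_le])
        subgoal by (auto simp: frameD[where s = s1] elim: frame_trans)
        subgoal by simp
        subgoal by simp
        subgoal for i s3
          apply (rule wp_If)
          subgoal by (rule wp_NAssign) (auto simp: g split: if_splits)
          subgoal by (rule wp_Skip) (auto simp: g split: if_splits)
          done
        subgoal by simp
        done
      done
    subgoal for s' by (rule post) (auto simp: cut_size_def)
    done
qed

text \<open>Before the first nonempty cut, variables 15 and 16 hold 1 and 0, which acts as the ratio
  infinity when ratios are compared by cross multiplication.\<close>

definition best :: "nat set set \<Rightarrow> memory \<Rightarrow> bool" where
  "best F s \<longleftrightarrow> 2 * card (output_set n s) \<le> n \<and> fst s (n + 16) = card (output_set n s) \<and>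
     fst s (n + 15) = (if output_set n s = {} then 1 else cut_size (output_set n s)) \<and>
     (\<forall>S\<in>F. fst s (n + 15) * card S \<le> cut_size S * fst s (n + 16))"

text \<open>\<open>best\<close> reads only the output cells and variables 15 and 16.\<close>

lemma best_frame:
  assumes "frame M s s'" "M \<inter> ({..<n} \<union> {n + 15, n + 16}) = {}"
  shows "best F s' = best F s"
proof -
  have "fst s' v = fst s v" if "v < n \<or> v = n + 15 \<or> v = n + 16" for v
    using assms that by (intro frameD[OF assms(1)]) auto
  then show ?thesis by (simp add: best_def output_set_def cong: conj_cong)
qed

lemma best_upd [simp]:
  "n \<le> a \<Longrightarrow> a \<noteq> n + 15 \<Longrightarrow> a \<noteq> n + 16 \<Longrightarrow> best F (f(a := x), h) = best F (f, h)"
  by (rule best_frame[of "{a}"]) (auto simp: frame_def)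

lemma best_fst [simp]: "best F (fst s, h) = best F s"
  by (simp only: best_def output_set_def fst_conv)

lemma best_insert:
  "best F s \<Longrightarrow> fst s (n + 15) * card S \<le> cut_size S * fst s (n + 16) \<Longrightarrow> best (insert S F) s"
  unfolding best_def by blast

text \<open>Transitivity of the order on fractions, by cancelling the old denominator. If that is 0,
  no cut has been saved yet and the old invariant forces all earlier candidates to be empty.\<close>

lemma best_improve:
  assumes b: "best F s" and S: "2 * card S \<le> n" "S \<subseteq> {..<n}"
    and less: "cut_size S * fst s (n + 16) < card S * fst s (n + 15)"
    and s': "output_set n s' = S" "fst s' (n + 15) = cut_size S" "fst s' (n + 16) = card S"
  shows "best (insert S F) s'"
proof -
  let ?e = "fst s (n + 15)" and ?b = "fst s (n + 16)"
  have fin: "finite S" using S(2) finite_subset by blast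
  have ne: "S \<noteq> {}" using less by auto
  have all: "\<forall>X\<in>F. ?e * card X \<le> cut_size X * ?b" using b unfolding best_def by blast
  have "cut_size S * card X \<le> cut_size X * card S" if "X \<in> F" for X
  proof (cases "?b = 0")
    case True
    then have "output_set n s = {}" using b by (simp add: best_def output_set_def)
    then have "?e = 1" using b by (simp add: best_def)
    then have "card X = 0" using all that True by fastforce
    then show ?thesis by (metis mult_0_right zero_le)
  next
    case False
    have 1: "?e * card X \<le> cut_size X * ?b" using all that by blast
    have "?b * (cut_size S * card X) = (cut_size S * ?b) * card X" by simp
    also have "\<dots> \<le> (card S * ?e) * card X" using less by (intro mult_le_mono1) simp
    also have "\<dots> = card S * (?e * card X)" by simp
    also have "\<dots> \<le> card S * (cut_size X * ?b)" using 1 by (rule mult_le_mono2)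
    also have "\<dots> = ?b * (cut_size X * card S)" by simp
    finally show ?thesis using False by simp
  qed
  then show ?thesis using S s' ne by (simp add: best_def)
qed

lemma wp_save:
  assumes S: "ind S s" "S \<subseteq> {..<n}" "fst s (n + 11) = card S" "fst s (n + 12) = cut_size S"
      "2 * card S \<le> n"
    and b: "best F s"
    and post: "\<And>s'. frame ({..<n} \<union> {n + 2, n + 5} \<union> {n + 10..}) s s' \<Longrightarrow> snd s' = snd s \<Longrightarrow>
      best (insert S F) s' \<Longrightarrow> Q s'"
  shows "wp inp z save_prog Q s"
proof -
  let ?M = "{..<n} \<union> {n + 2, n + 5} \<union> {n + 10..}"
  \<comment> \<open>Both multiplications use a cardinality as loop count, because numbers of edges
    are not known to be at most \<open>z\<close>.\<close>
  have le: "fst s (n + 16) \<le> z" "card S \<le> z"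
    using b S(5) n_le by (auto simp: best_def)
  show ?thesis
    unfolding save_prog_def
    apply (rule wp_Seq, rule wp_Mul)
    subgoal by simp
    subgoal using le by simp
    subgoal by (simp add: frame_def)
    subgoal by (simp add: frame_def)
    subgoal for s1
      apply (rule wp_Seq, rule wp_Mul)
      subgoal by simp
      subgoal using le S by (simp add: frame_def)
      subgoal by (simp add: frame_def)
      subgoal by (simp add: frame_def)
      subgoal premises p for s2
      proof -
        let ?K = "{n + 5, n + 13, n + 14}"
        have f: "frame ?K s s2" by (rule frame_trans[OF p(1,4)]) auto
        have fM: "frame ?M s s2" by (rule frame_trans[OF f frame_refl[of "{}"]]) auto
        have snd: "snd s2 = snd s" using p by simp
        have v: "fst s2 (n + 11) = card S" "fst s2 (n + 12) = cut_size S"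
          "fst s2 (n + 15) = fst s (n + 15)" "fst s2 (n + 16) = fst s (n + 16)"
          using S by (simp_all add: frameD[OF f])
        have v13: "fst s2 (n + 13) = fst s (n + 16) * cut_size S"
          using p(3) S(4) frameD[OF p(4), of "n + 13"] by simp
        have v14: "fst s2 (n + 14) = card S * fst s (n + 15)"
          using p(6) S(3) frameD[OF p(1)] by simp
        have g: "ind S s2" using S(1) frameD[OF f] by (simp add: ind_def)
        have b2: "best F s2" using b best_frame[OF f] by simp
        show ?thesis
          apply (rule wp_If)
          subgoal
            apply (rule wp_Seq)
            apply (rule wp_For[where N = n and J = "\<lambda>j s'. frame ({..<n} \<union> {n + 2}) s2 s' \<and> snd s' = snd s \<and>
               (\<forall>v<n. v < j \<longrightarrow> fst s' v = (if v \<in> S then 1 else 0))", OF n_le])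
            subgoal using snd by simp
            subgoal by auto
            subgoal by simp
            subgoal for j s' using g frameD[of "{..<n} \<union> {n + 2}" s2 s' "n + 17 + j"]
              by (intro wp_NAssign) (auto simp: less_Suc_eq ind_def)
            subgoal premises q for s3
              apply (intro wp_Seq wp_NAssign, rule post)
              subgoal
              proof -
                have "frame ?M s s3" by (rule frame_trans[OF fM conjunct1[OF q(2)]]) auto
                then show ?thesis by simp
              qed
              subgoal using q by simp
              subgoal
                apply (rule best_improve[OF b2 S(5,2)])
                subgoal using q(1) v v13 v14 by (simp add: mult.commute)
                subgoal using S(2) q(2) by (auto simp: output_set_def split: if_splits)
                subgoal using q(2) v by (simp add: frame_def)
                subgoal using q(2) v by (simp add: frame_def)
                done
              done
            done
          subgoal
            apply (rule wp_Skip, rule post[OF fM snd])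
            subgoal using best_insert[OF b2, of S] v v13 v14 by (simp add: mult.commute)
            done
          done
      qed
      done
    done
qed

lemma wp_try:
  assumes b: "best F s"
    and post: "\<And>s'. frame ({..<n} \<union> {n + 2, n + 4, n + 5} \<union> {n + 10..}) s s' \<Longrightarrow> snd s' = snd s \<Longrightarrow>
      best (insert (small_side {v. v < n \<and> snd s v \<le> snd s (fst s (n + 3))}) F) s' \<Longrightarrow> Q s'"
  shows "wp inp z try_prog Q s"
  unfolding try_prog_def
proof (rule wp_Seq, rule wp_mark, rule wp_Seq)
  let ?S = "{v. v < n \<and> snd s v \<le> snd s (fst s (n + 3))}"
  let ?M = "{..<n} \<union> {n + 2, n + 4, n + 5} \<union> {n + 10..}"
  fix s1 assume 1: "frame ({n + 2, n + 11} \<union> {n + 17..}) s s1" "snd s1 = snd s" "ind ?S s1"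
    "fst s1 (n + 11) = card ?S"
  show "wp inp z flip_prog (wp inp z (Seq cut_prog save_prog) Q) s1"
  proof (rule wp_flip[OF 1(3) _ 1(4)], force, rule wp_Seq)
    fix s2 assume 2: "frame ({n + 2, n + 11} \<union> {n + 17..}) s1 s2" "snd s2 = snd s1"
      "ind (small_side ?S) s2" "fst s2 (n + 11) = card (small_side ?S)"
    show "wp inp z cut_prog (wp inp z save_prog Q) s2"
    proof (rule wp_cut[OF 2(3)])
      fix s3 assume 3: "frame {n + 2, n + 4, n + 5, n + 10, n + 12} s2 s3" "snd s3 = snd s2"
        "fst s3 (n + 12) = cut_size (small_side ?S)"
      have S: "?S \<subseteq> {..<n}" by auto
      then have sub: "small_side ?S \<subseteq> {..<n}" by (auto simp: small_side_def)
      have card: "2 * card (small_side ?S) \<le> n"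
        using card_Diff_subset[of ?S "{..<n}"] by (auto simp: small_side_def subset_iff)
      have i3: "ind (small_side ?S) s3" using 2(3) frameD[OF 3(1)] by (simp add: ind_def)
      have c3: "fst s3 (n + 11) = card (small_side ?S)" using 2(4) frameD[OF 3(1)] by simp
      have b1: "best F s1" using b best_frame[OF 1(1), of F] by force
      then have b2: "best F s2" using best_frame[OF 2(1), of F] by force
      then have b3: "best F s3" using best_frame[OF 3(1), of F] by simp
      have f2: "frame ?M s s2" by (rule frame_trans[OF 1(1) 2(1)]) auto
      have f3: "frame ?M s s3" by (rule frame_trans[OF f2 3(1)]) auto
      show "wp inp z save_prog Q s3"
      proof (rule wp_save[OF i3 sub c3 3(3) card b3])
        fix s4 assume 4: "frame ({..<n} \<union> {n + 2, n + 5} \<union> {n + 10..}) s3 s4" "snd s4 = snd s3"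
          "best (insert (small_side ?S) F) s4"
        have "frame ?M s s4" by (rule frame_trans[OF f3 4(1)]) auto
        then show "Q s4" using 1 2 3 4 by (intro post) simp_all
      qed
    qed
  qed
qed


section \<open>Enumerating rows, centres and thresholds\<close>

text \<open>On an encoded solution this is \<open>d R b v w + d R b w v\<close> for the pair
  \<open>(R, b)\<close> at position \<open>l\<close>: the tables of \<open>n * n\<close> distances
  come after \<open>n * m\<close> coordinates and one value of \<open>p\<close> per pair.\<close>

definition sweep_dist :: "nat \<Rightarrow> nat \<Rightarrow> nat \<Rightarrow> real" where
  "sweep_dist l w v = rin inp (n * nin inp 3 + nin inp 4 + l * (n * n) + (v * n + w))
     + rin inp (n * nin inp 3 + nin inp 4 + l * (n * n) + (w * n + v))"

definition candidate :: "nat \<Rightarrow> nat \<Rightarrow> nat \<Rightarrow> nat set" where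
  "candidate l w u = small_side {v. v < n \<and> sweep_dist l w v \<le> sweep_dist l w u}"

lemma wp_fill:
  assumes vars: "fst s (n + 7) = n * nin inp 3" "fst s (n + 8) = l * (n * n)" "fst s (n + 1) = w"
      "fst s (n + 9) = w * n"
    and post: "\<And>s'. frame {n + 2, n + 5, n + 10} s s' \<Longrightarrow>
      (\<forall>v<n. snd s' v = sweep_dist l w v) \<Longrightarrow> Q s'"
  shows "wp inp z fill_prog Q s"
  unfolding fill_prog_def
  apply (rule wp_For[where N = n and J = "\<lambda>j s'. frame {n + 2, n + 5, n + 10} s s' \<and>
      (\<forall>v<j. snd s' v = sweep_dist l w v)", OF n_le])
  subgoal by simp
  subgoal by simp
  subgoal by simp
  subgoal for j s1
    apply (rule wp_Seq, rule wp_Mul)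
    subgoal by simp
    subgoal using n_le by simp
    subgoal by (simp add: frame_def)
    subgoal by (simp add: frame_def)
    subgoal premises p for s2
    proof -
      have f: "frame {n + 2, n + 5, n + 10} s s2"
        by (rule frame_trans[OF conjunct1[OF p(2)] p(4)]) auto
      have "fst s2 (n + 2) = j" "fst s2 (n + 10) = j * n"
        using p frameD[OF p(4), of "n + 2"] by simp_all
      moreover have "fst s2 (n + 7) = n * nin inp 3" "fst s2 (n + 8) = l * (n * n)"
          "fst s2 (n + 1) = w" "fst s2 (n + 9) = w * n"
        using vars frameD[OF f] by simp_all
      ultimately show ?thesis
        using p(2,5) f by (intro wp_RAssign) (simp add: All_less_Suc sweep_dist_def)
    qed
    done
  subgoal for s' by (rule post) auto
  done

lemma best_mono: "best F s \<Longrightarrow> F' \<subseteq> F \<Longrightarrow> best F' s"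
  unfolding best_def by blast

text \<open>The family in \<open>best\<close> grows with each loop: all rows before
  \<open>l\<close>, then the centres of row \<open>l\<close>, then the thresholds of one centre. The
  frame spares variables 0, 6 and 7, which the outer loop relies on.\<close>

lemma wp_row:
  assumes b: "best {candidate l' w u | l' w u. l' < l \<and> w < n \<and> u < n} s"
    and vars: "fst s n = l" "fst s (n + 6) = n * n" "fst s (n + 7) = n * nin inp 3"
    and l: "l \<le> z"
    and post: "\<And>s'. frame ({..<n} \<union> {n + 1..n + 5} \<union> {n + 8..}) s s' \<Longrightarrow>
      best {candidate l' w u | l' w u. l' < Suc l \<and> w < n \<and> u < n} s' \<Longrightarrow> Q s'"
  shows "wp inp z row_prog Q s"
proof -
  let ?M = "{..<n} \<union> {n + 1..n + 5} \<union> {n + 8..}"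
  let ?F = "\<lambda>l. {candidate l' w u | l' w u. l' < l \<and> w < n \<and> u < n}"
  let ?W = "\<lambda>i. {candidate l w u | w u. w < i \<and> u < n}"
  have W: "?F l \<union> ?W n = ?F (Suc l)" by (auto simp: less_Suc_eq)
  have row: "wp inp z (Seq (Mul 9 (var 1) inN) (Seq fill_prog (For 3 inN try_prog)))
      (\<lambda>s'. (frame ?M s s' \<and> fst s' (n + 8) = l * (n * n) \<and> best (?F l \<union> ?W (Suc w)) s') \<and>
        fst s' (n + 1) = w) s1"
    if w: "w < n" and s1: "frame ?M s s1" "fst s1 (n + 8) = l * (n * n)" "best (?F l \<union> ?W w) s1"
      "fst s1 (n + 1) = w" for w s1
  proof (rule wp_Seq, rule wp_Mul)
    fix s2 assume 2: "frame {n + 9, n + 5} s1 s2"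
      "fst s2 (n + 9) = nval inp s1 (var 1) * nval inp s1 inN"
    show "wp inp z (Seq fill_prog (For 3 inN try_prog))
      (\<lambda>s'. (frame ?M s s' \<and> fst s' (n + 8) = l * (n * n) \<and> best (?F l \<union> ?W (Suc w)) s') \<and>
        fst s' (n + 1) = w) s2"
    proof (rule wp_Seq, rule wp_fill)
      show "fst s2 (n + 7) = n * nin inp 3" "fst s2 (n + 8) = l * (n * n)" "fst s2 (n + 1) = w"
          "fst s2 (n + 9) = w * n"
        using vars s1 2 frameD[OF s1(1), of "n + 7"] frameD[OF 2(1)] by simp_all
      note v2 = this
      fix s3 assume 3: "frame {n + 2, n + 5, n + 10} s2 s3" "\<forall>v<n. snd s3 v = sweep_dist l w v"
      have v3: "fst s3 (n + 8) = l * (n * n)" "fst s3 (n + 1) = w"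
        using v2 frameD[OF 3(1)] by simp_all
      have "frame ?M s s2" by (rule frame_trans[OF s1(1) 2(1)]) auto
      then have f3: "frame ?M s s3" by (rule frame_trans[OF _ 3(1)]) auto
      have b2: "best (?F l \<union> ?W w) s2" using s1(3) best_frame[OF 2(1)] by auto
      then have b3: "best (?F l \<union> ?W w) s3" using best_frame[OF 3(1)] by auto
      \<comment> \<open>This smaller frame also spares variables 1, 8 and 9, so the centre and the
        row offsets survive the innermost loop.\<close>
      let ?K = "{..<n} \<union> {n + 2..n + 5} \<union> {n + 10..}"
      show "wp inp z (For 3 inN try_prog)
        (\<lambda>s'. (frame ?M s s' \<and> fst s' (n + 8) = l * (n * n) \<and> best (?F l \<union> ?W (Suc w)) s') \<and>
        fst s' (n + 1) = w) s3"
      proof (rule wp_For[where N = n and J = "\<lambda>i s'. frame ?K s3 s' \<and> snd s' = snd s3 \<and>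
          best ((?F l \<union> ?W w) \<union> candidate l w ` {..<i}) s'", OF n_le])
        show "frame ?K s3 s3 \<and> snd s3 = snd s3 \<and>
            best ((?F l \<union> ?W w) \<union> candidate l w ` {..<0}) s3"
          using b3 by simp
      next
        fix u s4
        assume u: "u < n" "fst s4 (n + 3) = u" and 4: "frame ?K s3 s4 \<and> snd s4 = snd s3 \<and>
          best ((?F l \<union> ?W w) \<union> candidate l w ` {..<u}) s4"
        then have b4: "best ((?F l \<union> ?W w) \<union> candidate l w ` {..<u}) s4" by blast
        have c: "small_side {v. v < n \<and> snd s4 v \<le> snd s4 (fst s4 (n + 3))} = candidate l w u"
          using 3(2) 4 u by (simp add: candidate_def cong: conj_cong)
        show "wp inp z try_prog (\<lambda>s'. (frame ?K s3 s' \<and> snd s' = snd s3 \<and>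
          best ((?F l \<union> ?W w) \<union> candidate l w ` {..<Suc u}) s') \<and> fst s' (n + 3) = u) s4"
        proof (rule wp_try[OF b4])
          fix s5 assume 5: "frame ({..<n} \<union> {n + 2, n + 4, n + 5} \<union> {n + 10..}) s4 s5" "snd s5 = snd s4"
            "best (insert (small_side {v. v < n \<and> snd s4 v \<le> snd s4 (fst s4 (n + 3))})
              ((?F l \<union> ?W w) \<union> candidate l w ` {..<u})) s5"
          have "frame ?K s3 s5" by (rule frame_trans[OF conjunct1[OF 4] 5(1)]) auto
          moreover have "fst s5 (n + 3) = u" using u(2) frameD[OF 5(1)] by simp
          moreover have "best ((?F l \<union> ?W w) \<union> candidate l w ` {..<Suc u}) s5"
            by (rule best_mono[OF 5(3)]) (auto simp: c lessThan_Suc)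
          ultimately show "(frame ?K s3 s5 \<and> snd s5 = snd s3 \<and>
            best ((?F l \<union> ?W w) \<union> candidate l w ` {..<Suc u}) s5) \<and> fst s5 (n + 3) = u"
            using 4 5(2) by simp
        qed
      next
        fix s4 assume 4: "frame ?K s3 s4 \<and> snd s4 = snd s3 \<and>
          best ((?F l \<union> ?W w) \<union> candidate l w ` {..<n}) s4"
        have "frame ?M s s4" by (rule frame_trans[OF f3 conjunct1[OF 4]]) auto
        moreover have "best (?F l \<union> ?W (Suc w)) s4"
          by (rule best_mono[of "(?F l \<union> ?W w) \<union> candidate l w ` {..<n}"])
            (use 4 in \<open>auto simp: less_Suc_eq\<close>)
        ultimately show "(frame ?M s s4 \<and> fst s4 (n + 8) = l * (n * n) \<and>
            best (?F l \<union> ?W (Suc w)) s4) \<and> fst s4 (n + 1) = w"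
          using v3 frameD[OF conjunct1[OF 4]] by simp
      qed auto
    qed
  qed (use s1 w n_le in \<open>auto simp: frame_def\<close>)
  show ?thesis
    unfolding row_prog_def
  proof (rule wp_Seq, rule wp_Mul)
    fix s1 assume 1: "frame {n + 8, n + 5} s s1" "fst s1 (n + 8) = nval inp s (var 0) * nval inp s (var 6)"
    have b1: "best (?F l) s1" using b best_frame[OF 1(1)] by auto
    have f1: "frame ?M s s1" by (rule frame_trans[OF 1(1) frame_refl[of "{}"]]) auto
    show "wp inp z (For 1 inN (Seq (Mul 9 (var 1) inN) (Seq fill_prog (For 3 inN try_prog)))) Q s1"
    proof (rule wp_For[where N = n and J = "\<lambda>i s'. frame ?M s s' \<and> fst s' (n + 8) = l * (n * n) \<and>
        best (?F l \<union> ?W i) s'", OF n_le])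
      show "frame ?M s s1 \<and> fst s1 (n + 8) = l * (n * n) \<and> best (?F l \<union> ?W 0) s1"
        using f1 b1 1(2) vars by simp
    next
      fix s' assume "frame ?M s s' \<and> fst s' (n + 8) = l * (n * n) \<and> best (?F l \<union> ?W n) s'"
      then show "Q s'" unfolding W by (intro post) auto
    qed (use row in auto)
  qed (use vars l in \<open>auto simp: frame_def\<close>)
qed

lemma wp_sweep:
  assumes "nin inp 4 \<le> z"
  shows "wp inp z sweep_prog (best {candidate l w u | l w u. l < nin inp 4 \<and> w < n \<and> u < n})
    (\<lambda>_. 0, \<lambda>_. 0)"
  unfolding sweep_prog_def
proof (rule wp_Seq, rule wp_NAssign, rule wp_Seq, rule wp_Mul)
  let ?F = "\<lambda>l. {candidate l' w u | l' w u. l' < l \<and> w < n \<and> u < n}"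
  let ?z = "(\<lambda>_. 0, \<lambda>_. 0) :: memory"
  let ?s0 = "((fst ?z)(nval inp ?z (addr 15) := nval inp ?z (NConst 1)), snd ?z)"
  have b0: "best {} ?s0" by (auto simp: best_def output_set_def)
  fix s1 assume 1: "frame {n + 6, n + 5} ?s0 s1" "fst s1 (n + 6) = nval inp ?s0 inN * nval inp ?s0 inN"
  have b1: "best {} s1" using b0 best_frame[OF 1(1)] by auto
  show "wp inp z (Seq (Mul 7 inN (NInput (NConst 3))) (For 0 (NInput (NConst 4)) row_prog))
     (best (?F (nin inp 4))) s1"
  proof (rule wp_Seq, rule wp_Mul)
    fix s2 assume 2: "frame {n + 7, n + 5} s1 s2"
      "fst s2 (n + 7) = nval inp s1 inN * nval inp s1 (NInput (NConst 3))"
    have b2: "best {} s2" using b1 best_frame[OF 2(1)] by auto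
    have "fst s2 (n + 6) = n * n" using 1(2) frameD[OF 2(1)] by simp
    then show "wp inp z (For 0 (NInput (NConst 4)) row_prog) (best (?F (nin inp 4))) s2"
      using 2(2) b2
    proof (intro wp_For[where N = "nin inp 4" and J = "\<lambda>l s'. fst s' (n + 6) = n * n \<and>
        fst s' (n + 7) = n * nin inp 3 \<and> best (?F l) s'"] assms)
      fix l s3
      assume l: "l < nin inp 4" "fst s3 (n + 0) = l" and 3: "fst s3 (n + 6) = n * n \<and>
        fst s3 (n + 7) = n * nin inp 3 \<and> best (?F l) s3"
      show "wp inp z row_prog (\<lambda>s'. (fst s' (n + 6) = n * n \<and> fst s' (n + 7) = n * nin inp 3 \<and>
          best (?F (Suc l)) s') \<and> fst s' (n + 0) = l) s3"
        using l 3 assms by (intro wp_row[of l s3]) (auto simp: frame_def)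
    qed auto
  qed (use n_le in \<open>auto simp: frame_def\<close>)
qed (use n_le in \<open>auto simp: frame_def\<close>)

end

section \<open>Existence of a sparse sweep cut\<close>

lemma measure_Ico: "measure lborel {x..<y} = max 0 (y - x :: real)"
  by (cases "x \<le> y") auto

lemma finite_measure_Ico: "emeasure lborel {x..<y :: real} < \<infinity>"
  by (cases "x \<le> y") auto

text \<open>Integrate the hypothesis over all thresholds \<open>t\<close>.\<close>

lemma coarea:
  fixes f :: "'a \<Rightarrow> real"
  assumes V: "finite V" "E \<subseteq> V \<times> V"
    and cut: "\<And>u S. u \<in> V \<Longrightarrow> S = {v \<in> V. f v \<le> f u} \<Longrightarrow>
      \<beta> * (real (card S) * real (card (V - S))) \<le> real (card (E \<inter> S \<times> (V - S)))"
  shows "\<beta> * (\<Sum>(a, b)\<in>V \<times> V. max 0 (f b - f a)) \<le> (\<Sum>(a, b)\<in>E. max 0 (f b - f a))"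
proof -
  have finE: "finite E" using V by (meson finite_SigmaI finite_subset)
  \<comment> \<open>The pair \<open>(a, b)\<close> leaves the sublevel set of \<open>t\<close>
    exactly for \<open>t\<close> in \<open>{f a..<f b}\<close>, an interval of length
    \<open>max 0 (f b - f a)\<close>.\<close>
  have int: "(\<integral>t. (\<Sum>(a, b)\<in>F. indicator {f a..<f b} t) \<partial>lborel) = (\<Sum>(a, b)\<in>F. max 0 (f b - f a))"
    "integrable lborel (\<lambda>t. \<Sum>(a, b)\<in>F. indicator {f a..<f b} t :: real)" if "finite F" for F
  proof -
    have i: "integrable lborel (indicator {x..<y} :: real \<Rightarrow> real)" for x y
      using finite_measure_Ico by (intro integrable_real_indicator) auto
    show "(\<integral>t. (\<Sum>(a, b)\<in>F. indicator {f a..<f b} t) \<partial>lborel) = (\<Sum>(a, b)\<in>F. max 0 (f b - f a))"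
      using i by (simp add: case_prod_beta measure_Ico)
    show "integrable lborel (\<lambda>t. \<Sum>(a, b)\<in>F. indicator {f a..<f b} t :: real)"
      using i by (simp add: case_prod_beta)
  qed
  have count: "(\<Sum>(a, b)\<in>F. indicator {f a..<f b} t :: real)
      = real (card (F \<inter> {v \<in> V. f v \<le> t} \<times> (V - {v \<in> V. f v \<le> t})))" if "F \<subseteq> V \<times> V" "finite F" for F t
  proof -
    have "F \<inter> {v \<in> V. f v \<le> t} \<times> (V - {v \<in> V. f v \<le> t}) = {e \<in> F. f (fst e) \<le> t \<and> t < f (snd e)}"
      using that by auto
    moreover have "(\<Sum>(a, b)\<in>F. indicator {f a..<f b} t :: real)
        = (\<Sum>e\<in>F. if f (fst e) \<le> t \<and> t < f (snd e) then 1 else 0)"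
      by (intro sum.cong) (auto simp: indicator_def)
    ultimately show ?thesis using that(2) by (simp add: sum.If_cases Int_def)
  qed
  have point: "\<beta> * (\<Sum>(a, b)\<in>V \<times> V. indicator {f a..<f b} t) \<le> (\<Sum>(a, b)\<in>E. indicator {f a..<f b} t)" for t
  proof -
    let ?S = "{v \<in> V. f v \<le> t}"
    have *: "V \<times> V \<inter> ?S \<times> (V - ?S) = ?S \<times> (V - ?S)" by auto
    have "\<beta> * (real (card ?S) * real (card (V - ?S))) \<le> real (card (E \<inter> ?S \<times> (V - ?S)))"
    proof (cases "?S = {}")
      case True
      then show ?thesis by (simp only:) simp
    next
      case False
      have fin: "finite (f ` ?S)" using V by auto
      \<comment> \<open>A nonempty sublevel set is also the sublevel set of the largest value
        attained on it, so the hypothesis on thresholds \<open>f u\<close> covers every real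
        \<open>t\<close>.\<close>
      obtain u where u: "u \<in> ?S" "f u = Max (f ` ?S)"
        using Max_in[OF fin] False by (metis (no_types, lifting) empty_is_image imageE)
      then have "?S = {v \<in> V. f v \<le> f u}" using Max_ge[OF fin] by fastforce
      then show ?thesis using cut[of u ?S] u by blast
    qed
    then show ?thesis
      using count[of E t] count[of "V \<times> V" t] finE V by (simp add: * card_cartesian_product)
  qed
  have "\<beta> * (\<Sum>(a, b)\<in>V \<times> V. max 0 (f b - f a))
      = (\<integral>t. \<beta> * (\<Sum>(a, b)\<in>V \<times> V. indicator {f a..<f b} t) \<partial>lborel)"
    using int[of "V \<times> V"] V by simp
  also have "\<dots> \<le> (\<integral>t. (\<Sum>(a, b)\<in>E. indicator {f a..<f b} t) \<partial>lborel)"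
    using int(2)[of "V \<times> V"] int(2)[OF finE] V point by (intro integral_mono) auto
  finally show ?thesis using int(1)[OF finE] by simp
qed

text \<open>Take the threshold of least ratio \<open>?e u / ?q u\<close>. Then \<open>coarea\<close>
  holds with this ratio as its constant, and comparison with \<open>le\<close> bounds the ratio by
  \<open>\<beta>\<close>.\<close>

lemma sweep_cut:
  fixes f :: "'a \<Rightarrow> real"
  assumes V: "finite V" "E \<subseteq> V \<times> V"
    and le: "(\<Sum>(a, b)\<in>E. max 0 (f b - f a)) \<le> \<beta> * (\<Sum>(a, b)\<in>V \<times> V. max 0 (f b - f a))"
    and pos: "0 < (\<Sum>(a, b)\<in>V \<times> V. max 0 (f b - f a))"
  obtains u where "u \<in> V" "{v \<in> V. f v \<le> f u} \<noteq> V"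
    "real (card (E \<inter> {v \<in> V. f v \<le> f u} \<times> (V - {v \<in> V. f v \<le> f u})))
      \<le> \<beta> * (real (card {v \<in> V. f v \<le> f u}) * real (card (V - {v \<in> V. f v \<le> f u})))"
proof -
  let ?S = "\<lambda>u. {v \<in> V. f v \<le> f u}"
  let ?W = "{u \<in> V. ?S u \<noteq> V}"
  let ?q = "\<lambda>u. real (card (?S u)) * real (card (V - ?S u))"
  let ?e = "\<lambda>u. real (card (E \<inter> ?S u \<times> (V - ?S u)))"
  have qpos: "0 < ?q u" if "u \<in> ?W" for u
  proof -
    have "u \<in> ?S u" "V - ?S u \<noteq> {}" using that by auto
    then show ?thesis using V by (auto simp: card_gt_0_iff intro!: mult_pos_pos)
  qed
  have "\<exists>a\<in>V. \<exists>b\<in>V. f a < f b"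
  proof (rule ccontr)
    assume "\<not> ?thesis"
    then have "(\<Sum>(a, b)\<in>V \<times> V. max 0 (f b - f a)) = 0" by (intro sum.neutral) force
    then show False using pos by simp
  qed
  then have "?W \<noteq> {}" by force
  moreover have "finite ?W" using V by simp
  ultimately have "\<exists>u. is_arg_min (\<lambda>u. ?e u / ?q u) (\<lambda>u. u \<in> ?W) u"
    by (intro ex_is_arg_min_if_finite)
  then obtain u where "is_arg_min (\<lambda>u. ?e u / ?q u) (\<lambda>u. u \<in> ?W) u" by blast
  then have u: "u \<in> ?W" and min: "\<And>v. v \<in> ?W \<Longrightarrow> ?e u / ?q u \<le> ?e v / ?q v"
    unfolding is_arg_min_linorder by blast+
  have "?e u / ?q u * (\<Sum>(a, b)\<in>V \<times> V. max 0 (f b - f a)) \<le> (\<Sum>(a, b)\<in>E. max 0 (f b - f a))"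
  proof (rule coarea[OF V])
    fix v S assume v: "v \<in> V" "S = ?S v"
    show "?e u / ?q u * (real (card S) * real (card (V - S))) \<le> real (card (E \<inter> S \<times> (V - S)))"
    proof (cases "S = V")
      case False
      then have "v \<in> ?W" using v by auto
      then show ?thesis using min[of v] qpos[of v] v(2) by (simp only: pos_le_divide_eq)
    qed simp
  qed
  then have "?e u / ?q u \<le> \<beta>" using le pos by (meson mult_le_cancel_right_pos order_trans)
  then have "?e u \<le> \<beta> * ?q u" using qpos[OF u] by (simp only: pos_divide_le_eq)
  then show thesis using that[of u] u by blast
qed

section \<open>Averaging over the assignments\<close>

text \<open>Markov's inequality for the ratio of \<open>g\<close> to \<open>p\<close> under the
  weights \<open>p\<close>, stated without division because \<open>p b\<close> may vanish.
  Strictness ensures that two such exceptional sets do not exhaust a total weight of 1.\<close>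

lemma weight_exceeding_lt_half:
  fixes g p :: "'b \<Rightarrow> real"
  assumes "finite B" "\<And>b. b \<in> B \<Longrightarrow> 0 \<le> g b" "(\<Sum>b\<in>B. g b) \<le> M"
  shows "(\<Sum>b | b \<in> B \<and> 2 * M * p b < g b. p b) < 1 / 2"
proof -
  let ?X = "{b. b \<in> B \<and> 2 * M * p b < g b}"
  show ?thesis
  proof (cases "?X = {}")
    case False
    have "2 * M * (\<Sum>b\<in>?X. p b) = (\<Sum>b\<in>?X. 2 * M * p b)" by (simp add: sum_distrib_left)
    also have "\<dots> < (\<Sum>b\<in>?X. g b)" using False assms(1) by (intro sum_strict_mono) auto
    also have "\<dots> \<le> (\<Sum>b\<in>B. g b)" using assms by (intro sum_mono2) auto
    also have "\<dots> \<le> M" by fact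
    finally have lt: "2 * M * (\<Sum>b\<in>?X. p b) < M" .
    moreover have "0 \<le> M" using assms(2,3) sum_nonneg[of B g] by force
    ultimately have "0 < M" by (cases "M = 0") auto
    then show ?thesis using lt by (simp add: mult.commute[of 2] mult.assoc)
  next
    case True
    then show ?thesis by (simp only:) simp
  qed
qed

text \<open>Otherwise each \<open>b\<close> of positive weight would lie in one of two exceptional
  sets, whose weights add up to less than 1.\<close>

lemma good_weight:
  fixes g h p :: "'b \<Rightarrow> real"
  assumes B: "finite B" "\<And>b. b \<in> B \<Longrightarrow> 0 \<le> p b" "(\<Sum>b\<in>B. p b) = 1"
    and g: "\<And>b. b \<in> B \<Longrightarrow> 0 \<le> g b" "(\<Sum>b\<in>B. g b) \<le> M"
    and h: "\<And>b. b \<in> B \<Longrightarrow> 0 \<le> h b" "(\<Sum>b\<in>B. h b) \<le> N"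
  obtains b where "b \<in> B" "0 < p b" "g b \<le> 2 * M * p b" "h b \<le> 2 * N * p b"
proof (rule ccontr)
  assume no: "\<not> thesis"
  let ?X = "{b. b \<in> B \<and> 2 * M * p b < g b}" and ?Y = "{b. b \<in> B \<and> 2 * N * p b < h b}"
  have "1 = (\<Sum>b\<in>B. p b)" using B by simp
  also have "\<dots> \<le> (\<Sum>b\<in>B. (if b \<in> ?X then p b else 0) + (if b \<in> ?Y then p b else 0))"
  proof (rule sum_mono)
    fix b assume b: "b \<in> B"
    then have "b \<in> ?X \<or> b \<in> ?Y \<or> p b = 0" using no that B(2)[of b] by force
    then show "p b \<le> (if b \<in> ?X then p b else 0) + (if b \<in> ?Y then p b else 0)"
      using B(2)[OF b] by auto
  qed
  also have "\<dots> = (\<Sum>b\<in>?X. p b) + (\<Sum>b\<in>?Y. p b)"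
    using B(1) by (simp add: sum.distrib sum.If_cases Int_def conj_commute)
  also have "\<dots> < 1 / 2 + 1 / 2"
    using weight_exceeding_lt_half[OF B(1) g] weight_exceeding_lt_half[OF B(1) h]
    by (rule add_strict_mono)
  finally show False by simp
qed

section \<open>Representatives and the good assignment\<close>

lemma diameter_ge:
  assumes "finite T" "u \<in> T" "v \<in> T"
  shows "\<delta> u v \<le> diameter_of \<delta> T"
proof -
  have "{\<delta> u v | u v. u \<in> T \<and> v \<in> T} = (\<lambda>(u, v). \<delta> u v) ` (T \<times> T)" by auto
  then have "finite {\<delta> u v | u v. u \<in> T \<and> v \<in> T}" using assms(1) by simp
  then show ?thesis unfolding diameter_of_def using assms by (auto intro!: Max_ge)
qed

text \<open>Of the first \<open>k\<close> and the last \<open>k\<close> sets, those with the larger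
  union account for at least half of the covered vertices.\<close>

lemma half_cover_representatives:
  fixes T :: "nat \<Rightarrow> 'a set"
  assumes V: "finite V" "k \<le> card V"
    and T: "\<And>i. i \<in> {1..2 * k} \<Longrightarrow> T i \<subseteq> V" "\<And>i. i \<in> {1..2 * k} \<Longrightarrow> diameter_of \<delta> (T i) \<le> c"
  obtains R U \<rho> where "R \<subseteq> V" "card R = k" "U \<subseteq> V" "card (\<Union>i\<in>{1..2 * k}. T i) \<le> 2 * card U"
    "\<And>v. v \<in> U \<Longrightarrow> \<rho> v \<in> R \<and> \<delta> v (\<rho> v) \<le> c"
proof -
  have split: "(\<Union>i\<in>{1..2 * k}. T i) = (\<Union>i\<in>{1..k}. T i) \<union> (\<Union>i\<in>{k + 1..2 * k}. T i)"
  proof -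
    have "{1..2 * k} = {1..k} \<union> {k + 1..2 * k}" by auto
    then show ?thesis by auto
  qed
  have "\<exists>I. I \<subseteq> {1..2 * k} \<and> card I = k \<and> card (\<Union>i\<in>{1..2 * k}. T i) \<le> 2 * card (\<Union>i\<in>I. T i)"
  proof (cases "card (\<Union>i\<in>{1..k}. T i) \<le> card (\<Union>i\<in>{k + 1..2 * k}. T i)")
    case True
    then have "card (\<Union>i\<in>{1..2 * k}. T i) \<le> 2 * card (\<Union>i\<in>{k + 1..2 * k}. T i)"
      unfolding split using card_Un_le[of "\<Union>i\<in>{1..k}. T i" "\<Union>i\<in>{k + 1..2 * k}. T i"] by linarith
    then show ?thesis by (intro exI[of _ "{k + 1..2 * k}"]) auto
  next
    case False
    then have "card (\<Union>i\<in>{1..2 * k}. T i) \<le> 2 * card (\<Union>i\<in>{1..k}. T i)"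
      unfolding split using card_Un_le[of "\<Union>i\<in>{1..k}. T i" "\<Union>i\<in>{k + 1..2 * k}. T i"] by linarith
    then show ?thesis by (intro exI[of _ "{1..k}"]) auto
  qed
  then obtain I where I: "I \<subseteq> {1..2 * k}" "card I = k"
    "card (\<Union>i\<in>{1..2 * k}. T i) \<le> 2 * card (\<Union>i\<in>I. T i)" by blast
  have finI: "finite I" using I(1) finite_subset by blast
  define q where "q i = (SOME v. v \<in> T i)" for i
  let ?J = "{i \<in> I. T i \<noteq> {}}"
  have q: "q i \<in> T i" if "i \<in> ?J" for i using that by (auto simp: q_def some_in_eq)
  have "card (q ` ?J) \<le> k"
    using card_image_le[of ?J q] card_mono[OF finI, of ?J] finI I(2) by fastforce
  moreover have "q ` ?J \<subseteq> V" using q T(1) I(1) by blast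
  \<comment> \<open>Representatives may coincide, and empty sets have none, but the relaxation only
    knows sets of exactly \<open>k\<close> vertices; \<open>k \<le> card V\<close> leaves room for
    padding.\<close>
  ultimately obtain R where R: "q ` ?J \<subseteq> R" "R \<subseteq> V" "card R = k"
    using exists_subset_between[of "q ` ?J" k V] V by blast
  have "\<exists>w. w \<in> R \<and> \<delta> v w \<le> c" if v: "v \<in> (\<Union>i\<in>I. T i)" for v
  proof -
    obtain i where i: "i \<in> I" "v \<in> T i" using v by blast
    have iT: "i \<in> {1..2 * k}" using i I(1) by blast
    have "q i \<in> T i" using q i by blast
    moreover have "finite (T i)" using T(1)[OF iT] V finite_subset by blast
    ultimately have "\<delta> v (q i) \<le> c" using diameter_ge[of "T i" v "q i" \<delta>] T(2)[OF iT] i by linarith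
    then show ?thesis using R(1) i by blast
  qed
  then obtain \<rho> where "\<And>v. v \<in> (\<Union>i\<in>I. T i) \<Longrightarrow> \<rho> v \<in> R \<and> \<delta> v (\<rho> v) \<le> c" by metis
  moreover have "(\<Union>i\<in>I. T i) \<subseteq> V" using T(1) I(1) by blast
  ultimately show thesis using that R I(3) by blast
qed

text \<open>The relaxation does not require \<open>d R b\<close> to be symmetric or nonnegative, but the triangle
  inequality makes its symmetrisation a semimetric.\<close>

lemma sparse_sweep_cut_exists:
  fixes V :: "'a set" and T :: "nat \<Rightarrow> 'a set"
  assumes G: "regular_graph V E r" "0 < r" and k: "k \<le> card V"
    and sa: "sherali_adams_feasible V k m x d p"
    and T: "\<And>i. i \<in> {1..2 * k} \<Longrightarrow> T i \<subseteq> V"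
      "\<And>i. i \<in> {1..2 * k} \<Longrightarrow> diameter_of (sqdist m x) (T i) \<le> 1 / 64"
      "real (card V) \<le> 2 * real (card (\<Union>i\<in>{1..2 * k}. T i))"
  obtains R b w u S where "(R, b) \<in> local_assignments V k" "w \<in> V" "u \<in> V"
    "S = {v \<in> V. d R b v w + d R b w v \<le> d R b u w + d R b w u}" "S \<noteq> V"
    "real (card (E \<inter> S \<times> (V - S)))
      \<le> 128 * real r * arv_cost V E r m x / real (card V) * (real (card S) * real (card (V - S)))"
proof -
  have fV: "finite V" and EV: "E \<subseteq> V \<times> V" and Vne: "V \<noteq> {}"
    using G by (auto simp: regular_graph_def)
  have finE: "finite E" using fV EV by (meson finite_SigmaI finite_subset)
  define n where "n = real (card V)"
  have n: "0 < n" using fV Vne by (simp add: n_def card_gt_0_iff)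
  obtain R U \<rho> where R: "R \<subseteq> V" "card R = k" and U: "U \<subseteq> V"
    and cU: "card (\<Union>i\<in>{1..2 * k}. T i) \<le> 2 * card U"
    and \<rho>: "\<And>v. v \<in> U \<Longrightarrow> \<rho> v \<in> R \<and> sqdist m x v (\<rho> v) \<le> 1 / 64"
    by (rule half_cover_representatives[OF fV k, of T "sqdist m x" "1 / 64"])
      (erule T(1), erule T(2), rule that)
  have nU: "n \<le> 4 * real (card U)" using T(3) cU unfolding n_def by linarith
  define D where "D b u v = d R b u v + d R b v u" for b u v
  let ?B = "R \<rightarrow>\<^sub>E {0, 1} :: ('a \<Rightarrow> nat) set"
  have finR: "finite R" using R fV finite_subset by blast
  then have finB: "finite ?B" by (intro finite_PiE) auto
  have loc: "(R, b) \<in> local_assignments V k" if "b \<in> ?B" for b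
    using that R by (auto simp: local_assignments_def)
  have sum_d: "(\<Sum>u\<in>V. \<Sum>v\<in>V. d R b u v) = n\<^sup>2 * p R b"
    and tri: "\<And>u v w. u \<in> V \<Longrightarrow> v \<in> V \<Longrightarrow> w \<in> V \<Longrightarrow> d R b u v \<le> d R b u w + d R b w v"
    and p_nonneg: "0 \<le> p R b"
    and zero: "\<And>u v. u \<in> R \<Longrightarrow> v \<in> R \<Longrightarrow> b u = b v \<Longrightarrow> d R b u v = 0" if "b \<in> ?B" for b
    using sa loc[OF that] unfolding sherali_adams_feasible_def n_def by blast+
  have sum_b: "\<And>u v. u \<in> V \<Longrightarrow> v \<in> V \<Longrightarrow> sqdist m x u v = (\<Sum>b\<in>?B. d R b u v)"
    and sum_p: "(\<Sum>b\<in>?B. p R b) = 1"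
    using sa R unfolding sherali_adams_feasible_def by blast+
  have sqsym: "sqdist m x u v = sqdist m x v u" for u v
    by (simp add: sqdist_def power2_commute)
  have sum_D: "(\<Sum>b\<in>?B. D b u v) = 2 * sqdist m x u v" if "u \<in> V" "v \<in> V" for u v
    using sum_b[OF that] sum_b[OF that(2,1)] sqsym[of u v] by (simp add: D_def sum.distrib)
  \<comment> \<open>The triangle inequality at \<open>u, u, u\<close> gives
    \<open>0 \<le> d R b u u\<close>, and at \<open>u, u, v\<close> it bounds this by
    \<open>D b u v\<close>.\<close>
  have D_nonneg: "0 \<le> D b u v" if "b \<in> ?B" "u \<in> V" "v \<in> V" for b u v
    using tri[OF that(1), of u u v] tri[OF that(1), of u u u] that by (simp add: D_def)
  have D_tri: "D b u v \<le> D b u w + D b w v" if "b \<in> ?B" "u \<in> V" "v \<in> V" "w \<in> V" for b u v w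
    using tri[OF that(1), of u v w] tri[OF that(1), of v u w] that by (simp add: D_def)
  have D_sym: "D b u v = D b v u" for b u v by (simp add: D_def)
  define cst where "cst = arv_cost V E r m x"
  have cE: "(\<Sum>(u, v)\<in>E. sqdist m x u v) = 2 * real r * n * cst"
    using G(2) n by (simp add: cst_def arv_cost_def n_def)
  \<comment> \<open>Symmetrising doubles the total over \<open>b\<close>: a distance of 1/64 to the
    representative becomes 1/32 for each vertex of \<open>U\<close>, and the total edge length
    becomes \<open>4 * real r * n * cst\<close>.\<close>
  obtain b where b: "b \<in> ?B" "0 < p R b"
    and A: "(\<Sum>v\<in>U. D b v (\<rho> v)) \<le> 2 * (n / 32) * p R b"
    and Bd: "(\<Sum>(u, v)\<in>E. D b u v) \<le> 2 * (4 * real r * n * cst) * p R b"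
  proof (rule good_weight[OF finB p_nonneg sum_p])
    show "0 \<le> (\<Sum>v\<in>U. D b v (\<rho> v))" if "b \<in> ?B" for b
      using that U \<rho> R by (intro sum_nonneg D_nonneg) auto
    show "0 \<le> (\<Sum>(u, v)\<in>E. D b u v)" if "b \<in> ?B" for b
      using EV by (intro sum_nonneg) (auto intro!: D_nonneg[OF that])
    have "(\<Sum>b\<in>?B. \<Sum>v\<in>U. D b v (\<rho> v)) = (\<Sum>v\<in>U. \<Sum>b\<in>?B. D b v (\<rho> v))"
      by (rule sum.swap)
    also have "\<dots> = (\<Sum>v\<in>U. 2 * sqdist m x v (\<rho> v))"
      using U \<rho> R by (intro sum.cong sum_D) auto
    also have "\<dots> \<le> (\<Sum>v\<in>U. 1 / 32)" using \<rho> by (intro sum_mono) force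
    also have "\<dots> \<le> n / 32" using card_mono[OF fV U] by (simp add: n_def)
    finally show "(\<Sum>b\<in>?B. \<Sum>v\<in>U. D b v (\<rho> v)) \<le> n / 32" .
    have "(\<Sum>b\<in>?B. \<Sum>(u, v)\<in>E. D b u v) = (\<Sum>e\<in>E. \<Sum>b\<in>?B. D b (fst e) (snd e))"
      by (simp add: case_prod_beta sum.swap[of _ E])
    also have "\<dots> = (\<Sum>e\<in>E. 2 * sqdist m x (fst e) (snd e))"
      using EV by (intro sum.cong sum_D) auto
    also have "\<dots> = 4 * real r * n * cst"
      using cE by (simp add: sum_distrib_left[symmetric] case_prod_beta)
    finally show "(\<Sum>b\<in>?B. \<Sum>(u, v)\<in>E. D b u v) \<le> 4 * real r * n * cst" by simp
  qed
  have finU: "finite U" using U fV finite_subset by blast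
  have "\<exists>j. n \<le> 8 * real (card {v \<in> U. b (\<rho> v) = j})"
  proof -
    have "U = {v \<in> U. b (\<rho> v) = 0} \<union> {v \<in> U. b (\<rho> v) = 1}"
      using b(1) \<rho> by (fastforce simp: PiE_def Pi_def)
    then have "card U \<le> card {v \<in> U. b (\<rho> v) = 0} + card {v \<in> U. b (\<rho> v) = 1}"
      using card_Un_le by metis
    then have "n \<le> 8 * real (card {v \<in> U. b (\<rho> v) = 0}) \<or> n \<le> 8 * real (card {v \<in> U. b (\<rho> v) = 1})"
      using nU by linarith
    then show ?thesis by blast
  qed
  then obtain j where j: "n \<le> 8 * real (card {v \<in> U. b (\<rho> v) = j})" by blast
  define Z where "Z = {v \<in> U. b (\<rho> v) = j}"
  have ZV: "Z \<subseteq> V" using U by (auto simp: Z_def)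
  have "Z \<noteq> {}" using j n unfolding Z_def[symmetric] by auto
  then obtain v0 where v0: "v0 \<in> Z" by blast
  define w where "w = \<rho> v0"
  have w: "w \<in> R" "w \<in> V" "b w = j" using v0 \<rho> R by (auto simp: w_def Z_def)
  define f where "f v = D b v w" for v
  have fZ: "f v \<le> D b v (\<rho> v)" if "v \<in> Z" for v
  proof -
    have v: "\<rho> v \<in> R" "b (\<rho> v) = j" "v \<in> V" using that \<rho> ZV by (auto simp: Z_def)
    then have "D b (\<rho> v) w = 0" using zero[OF b(1)] w by (simp add: D_def)
    then show ?thesis unfolding f_def using D_tri[OF b(1), of v w "\<rho> v"] v w R by auto
  qed
  \<comment> \<open>The vertices of \<open>Z\<close> are close to \<open>w\<close> on average, since
    their representatives are at distance 0 from \<open>w\<close>.\<close>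
  have "(\<Sum>v\<in>Z. f v) \<le> (\<Sum>v\<in>Z. D b v (\<rho> v))" using fZ by (rule sum_mono)
  also have "\<dots> \<le> (\<Sum>v\<in>U. D b v (\<rho> v))"
    using finU U \<rho> R by (intro sum_mono2) (auto simp: Z_def intro!: D_nonneg b(1))
  finally have sumZ: "(\<Sum>v\<in>Z. f v) \<le> n * p R b / 16" using A by simp
  \<comment> \<open>Since \<open>D b u v \<le> f u + f v\<close>, the normalisation of the pair
    distances forces \<open>f\<close> to be large on average over \<open>V\<close>.\<close>
  have "2 * n\<^sup>2 * p R b = (\<Sum>u\<in>V. \<Sum>v\<in>V. d R b u v) + (\<Sum>v\<in>V. \<Sum>u\<in>V. d R b v u)"
    using sum_d[OF b(1)] by simp
  also have "\<dots> = (\<Sum>u\<in>V. \<Sum>v\<in>V. D b u v)"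
    unfolding D_def sum.distrib by (subst (2) sum.swap) simp
  also have "\<dots> \<le> (\<Sum>u\<in>V. \<Sum>v\<in>V. f u + f v)"
    using D_tri[OF b(1) _ _ w(2)] by (intro sum_mono) (auto simp: f_def D_sym[of b w])
  also have "\<dots> = 2 * n * (\<Sum>v\<in>V. f v)"
    by (simp add: sum.distrib n_def sum_distrib_left[symmetric] sum_distrib_right[symmetric] algebra_simps)
  finally have sumV: "n * p R b \<le> (\<Sum>v\<in>V. f v)"
    using n by (simp add: power2_eq_square)
  \<comment> \<open>Summing \<open>f b - f a\<close> over \<open>Z \<times> V\<close>: the large
    average of \<open>f\<close> against at least \<open>n / 8\<close> points of \<open>Z\<close>
    contributes an eighth, and the small total of \<open>f\<close> on \<open>Z\<close> costs a
    sixteenth.\<close>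
  have "n\<^sup>2 * p R b / 16 \<le> (n / 8) * (n * p R b) - n * (n * p R b / 16)"
    by (simp add: power2_eq_square)
  also have "\<dots> \<le> real (card Z) * (\<Sum>v\<in>V. f v) - n * (\<Sum>v\<in>Z. f v)"
  proof (rule diff_mono)
    show "n / 8 * (n * p R b) \<le> real (card Z) * (\<Sum>v\<in>V. f v)"
      using sumV j n b(2) by (intro mult_mono) (auto simp: Z_def)
    show "n * (\<Sum>v\<in>Z. f v) \<le> n * (n * p R b / 16)"
      using sumZ n by (intro mult_left_mono) auto
  qed
  also have "\<dots> = (\<Sum>(a, b)\<in>Z \<times> V. f b - f a)"
    by (simp add: sum.cartesian_product[symmetric] sum_subtractf n_def sum_distrib_left[symmetric])
  also have "\<dots> \<le> (\<Sum>(a, b)\<in>Z \<times> V. max 0 (f b - f a))" by (intro sum_mono) auto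
  also have "\<dots> \<le> (\<Sum>(a, b)\<in>V \<times> V. max 0 (f b - f a))"
    using fV ZV by (intro sum_mono2) auto
  finally have spread: "n\<^sup>2 * p R b / 16 \<le> (\<Sum>(a, b)\<in>V \<times> V. max 0 (f b - f a))" .
  have "0 \<le> (\<Sum>(u, v)\<in>E. sqdist m x u v)" by (intro sum_nonneg) (auto simp: sqdist_def sum_nonneg)
  then have "0 \<le> 2 * real r * n * cst" using cE by simp
  moreover have "0 < 2 * real r * n" using G(2) n by simp
  ultimately have cst: "0 \<le> cst" using zero_le_mult_iff[of "2 * real r * n" cst] by linarith
  \<comment> \<open>As a distance from \<open>w\<close>, the function \<open>f\<close> is
    1-Lipschitz with respect to \<open>D b\<close>.\<close>
  have "(\<Sum>(a, b)\<in>E. max 0 (f b - f a)) \<le> (\<Sum>(a, c)\<in>E. D b a c)"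
  proof (rule sum_mono)
    fix e assume "e \<in> E"
    then obtain a c where e: "e = (a, c)" "a \<in> V" "c \<in> V" using EV by (cases e) auto
    then show "(case e of (a, b) \<Rightarrow> max 0 (f b - f a)) \<le> (case e of (a, c) \<Rightarrow> D b a c)"
      using D_tri[OF b(1), of c w a] D_nonneg[OF b(1), of a c] w D_sym[of b a c] by (simp add: f_def)
  qed
  \<comment> \<open>\<open>Bd\<close> bounds the edges by
    \<open>8 * real r * n * cst * p R b\<close>, and 128 is 8 times the 16 in the denominator of
    \<open>spread\<close>.\<close>
  also have "\<dots> \<le> 128 * real r * cst / n * (n\<^sup>2 * p R b / 16)"
    using Bd n by (simp add: power2_eq_square mult_ac)
  also have "\<dots> \<le> 128 * real r * cst / n * (\<Sum>(a, b)\<in>V \<times> V. max 0 (f b - f a))"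
    using spread cst n by (intro mult_left_mono) auto
  finally have le: "(\<Sum>(a, b)\<in>E. max 0 (f b - f a))
    \<le> 128 * real r * cst / n * (\<Sum>(a, b)\<in>V \<times> V. max 0 (f b - f a))" .
  have "0 < n\<^sup>2 * p R b / 16" using n b(2) by simp
  then have "0 < (\<Sum>(a, b)\<in>V \<times> V. max 0 (f b - f a))" using spread by linarith
  from sweep_cut[OF fV EV le this] obtain u where u: "u \<in> V" "{v \<in> V. f v \<le> f u} \<noteq> V"
    "real (card (E \<inter> {v \<in> V. f v \<le> f u} \<times> (V - {v \<in> V. f v \<le> f u})))
      \<le> 128 * real r * cst / n * (real (card {v \<in> V. f v \<le> f u}) * real (card (V - {v \<in> V. f v \<le> f u})))"
    by blast
  show thesis
    using that[OF loc[OF b(1)] w(2) u(1) refl] u(2,3)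
    unfolding f_def D_def cst_def n_def by blast
qed

section \<open>Correctness of the program on encoded solutions\<close>

lemma length_concat_uniform:
  "(\<And>ys. ys \<in> set xss \<Longrightarrow> length ys = c) \<Longrightarrow> length (concat xss) = length xss * c"
  by (induction xss) auto

lemma nth_concat_uniform:
  "(\<And>ys. ys \<in> set xss \<Longrightarrow> length ys = c) \<Longrightarrow> i < length xss \<Longrightarrow> j < c \<Longrightarrow>
    concat xss ! (i * c + j) = xss ! i ! j"
proof (induction xss arbitrary: i)
  case (Cons ys xss)
  then have "length ys = c" by simp
  with Cons show ?case by (cases i) (auto simp: nth_append add.assoc)
qed simp

lemma row_major_less: "i < a \<Longrightarrow> j < c \<Longrightarrow> i * c + j < a * (c::nat)"
proof -
  assume "i < a" "j < c"
  then have "i * c + j < Suc i * c" by simp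
  also have "\<dots> \<le> a * c" using \<open>i < a\<close> by (intro mult_le_mono1) simp
  finally show ?thesis .
qed

lemma length_table [simp]:
  "length (concat (map (\<lambda>u. map (g u) [0..<c]) xs)) = length xs * c"
  by (rule trans[OF length_concat_uniform[where c = c]]) auto

lemma nth_table:
  "i < length xs \<Longrightarrow> j < c \<Longrightarrow>
    concat (map (\<lambda>u. map (g u) [0..<c]) xs) ! (i * c + j) = g (xs ! i) j"
  by (subst nth_concat_uniform[where c = c]) auto

context
  fixes n :: nat and E :: "(nat \<times> nat) set" and r k :: nat
    and L :: "(nat set \<times> (nat \<Rightarrow> nat)) list" and m :: nat and x :: "nat \<Rightarrow> nat \<Rightarrow> real"
    and d :: "nat set \<Rightarrow> (nat \<Rightarrow> nat) \<Rightarrow> nat \<Rightarrow> nat \<Rightarrow> real" and p :: "nat set \<Rightarrow> (nat \<Rightarrow> nat) \<Rightarrow> real"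
begin

lemma nin_encode:
  "nin (encode n E r k L m x d p) 0 = n" "nin (encode n E r k L m x d p) 3 = m" "nin (encode n E r k L m x d p) 4 = length L"
  by (simp_all add: nin_def encode_def nth_append)

lemma nin_encode_edge:
  assumes "u < n" "v < n"
  shows "0 < nin (encode n E r k L m x d p) (5 + (u * n + v)) \<longleftrightarrow> (u, v) \<in> E"
  using row_major_less[OF assms] nth_table[of u "[0..<n]" v n "\<lambda>u v. if (u, v) \<in> E then 1 else 0 :: nat"] assms
  by (simp add: nin_def encode_def nth_append)

lemma rin_encode_dist:
  assumes "l < length L" "L ! l = (R, b)" "u < n" "v < n"
  shows "rin (encode n E r k L m x d p) (n * m + length L + l * (n * n) + (u * n + v)) = d R b u v"
proof -
  let ?t = "\<lambda>(R, b). concat (map (\<lambda>u. map (\<lambda>v. d R b u v) [0..<n]) [0..<n])"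
  have len: "length ys = n * n" if "ys \<in> set (map ?t L)" for ys using that by auto
  have uv: "u * n + v < n * n" using assms by (intro row_major_less)
  have "concat (map ?t L) ! (l * (n * n) + (u * n + v)) = map ?t L ! l ! (u * n + v)"
    using assms by (intro nth_concat_uniform[OF len] uv) auto
  also have "\<dots> = d R b u v" using assms nth_table[of u "[0..<n]" v n "\<lambda>u v. d R b u v"] by simp
  finally have eq: "concat (map ?t L) ! (l * (n * n) + (u * n + v)) = d R b u v" .
  have "length (concat (map ?t L)) = length (map ?t L) * (n * n)"
    by (rule length_concat_uniform[OF len])
  moreover have "l * (n * n) + (u * n + v) < length L * (n * n)"
    using assms uv by (intro row_major_less)
  ultimately show ?thesis
    using eq by (simp add: rin_def encode_def nth_append add.assoc)
qed

text \<open>The adjacency matrix and the list of values of \<open>p\<close> are part of the input,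
  so the input size is an admissible loop bound.\<close>

lemma input_size_encode: "n \<le> input_size (encode n E r k L m x d p)" "length L \<le> input_size (encode n E r k L m x d p)"
proof -
  have "n \<le> n * n" by (cases n) auto
  also have "n * n \<le> input_size (encode n E r k L m x d p)" by (simp add: input_size_def encode_def)
  finally show "n \<le> input_size (encode n E r k L m x d p)" .
  show "length L \<le> input_size (encode n E r k L m x d p)" by (simp add: input_size_def encode_def)
qed

lemma machine_encode: "machine (encode n E r k L m x d p) n (input_size (encode n E r k L m x d p))"
  using nin_encode(1) input_size_encode(1) by unfold_locales

lemma cut_size_encode:
  assumes "E \<subseteq> {..<n} \<times> {..<n}" "S \<subseteq> {..<n}"
  shows "machine.cut_size (encode n E r k L m x d p) n S = card (E \<inter> S \<times> ({..<n} - S))"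
proof -
  have "machine.cut_size (encode n E r k L m x d p) n S = (\<Sum>(v, y)\<in>{..<n} \<times> {..<n}. if (v, y) \<in> E \<inter> S \<times> ({..<n} - S) then 1 else 0)"
    unfolding machine.cut_size_def[OF machine_encode] sum.cartesian_product
  proof (intro sum.cong refl)
    fix e assume "e \<in> {..<n} \<times> {..<n}"
    then obtain v y where e: "e = (v, y)" "v < n" "y < n" by auto
    show "(case e of (v, y) \<Rightarrow> if v \<in> S \<and> y \<notin> S \<and> 0 < nin (encode n E r k L m x d p) (5 + (v * n + y)) then 1 else 0) =
        (case e of (v, y) \<Rightarrow> if (v, y) \<in> E \<inter> S \<times> ({..<n} - S) then 1 else (0::nat))"
      unfolding e(1) prod.case nin_encode_edge[OF e(2,3)] using e(3) by simp
  qed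
  also have "\<dots> = (\<Sum>e\<in>{..<n} \<times> {..<n}. if e \<in> E \<inter> S \<times> ({..<n} - S) then 1 else 0)"
    by (simp only: case_prod_unfold prod.collapse)
  also have "\<dots> = card (({..<n} \<times> {..<n}) \<inter> (E \<inter> S \<times> ({..<n} - S)))"
    by (simp add: sum.If_cases Int_def)
  also have "({..<n} \<times> {..<n}) \<inter> (E \<inter> S \<times> ({..<n} - S)) = E \<inter> S \<times> ({..<n} - S)"
    using assms by auto
  finally show ?thesis .
qed

text \<open>All encoded tuples are covered, as the running time has to be bounded on infeasible
  solutions too.\<close>

lemma sweep_prog_correct:
  obtains s where "final_memory sweep_prog (encode n E r k L m x d p) = return_pmf s"
    "machine.best (encode n E r k L m x d p) n {machine.candidate (encode n E r k L m x d p) n l w u | l w u. l < length L \<and> w < n \<and> u < n} s"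
    "halts_within sweep_prog (encode n E r k L m x d p) (cost (input_size (encode n E r k L m x d p)) sweep_prog)"
  using machine.wp_sweep[OF machine_encode] input_size_encode nin_encode
  by (auto elim!: wp_run intro: that)

end

section \<open>Running time and approximation guarantee\<close>

lemma polynomial_time_sweep_prog: "polynomial_time sweep_prog rounding_inputs"
proof -
  obtain a where a: "\<And>z. cost z sweep_prog \<le> a + z ^ a" using cost_polynomial by blast
  have "halts_within sweep_prog inp (a + input_size inp ^ a)" if inp: "inp \<in> rounding_inputs" for inp
  proof -
    obtain n E r k L m x d p where "inp = encode n E r k L m x d p"
      using inp unfolding rounding_inputs_def by blast
    then have "halts_within sweep_prog inp (cost (input_size inp) sweep_prog)"
      using sweep_prog_correct by metis
    then show ?thesis using halts_within_mono a by blast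
  qed
  then show ?thesis unfolding polynomial_time_def by blast
qed

text \<open>The cut from \<open>sparse_sweep_cut_exists\<close>, or its complement, is among the
  candidates, and the output has no larger ratio than any nonempty candidate.\<close>

lemma sweep_prog_expansion:
  assumes inst: "rounding_instance n E r k L"
    and sa: "sherali_adams_feasible {..<n} k m x d p"
    and T: "\<And>i. i \<in> {1..2 * k} \<Longrightarrow> T i \<subseteq> {..<n}"
      "\<And>i. i \<in> {1..2 * k} \<Longrightarrow> diameter_of (sqdist m x) (T i) \<le> 1 / 64"
      "real n \<le> 2 * real (card (\<Union>i\<in>{1..2 * k}. T i))"
  obtains s where "final_memory sweep_prog (encode n E r k L m x d p) = return_pmf s"
    "0 < card (output_set n s)" "2 * card (output_set n s) \<le> n"
    "expansion {..<n} E r (output_set n s) \<le> 128 * arv_cost {..<n} E r m x"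
proof -
  let ?inp = "encode n E r k L m x d p" and ?V = "{..<n}"
  have G: "regular_graph ?V E r" "0 < r" "k \<le> n" and L: "set L = local_assignments ?V k"
    using inst by (auto simp: rounding_instance_def)
  have EV: "E \<subseteq> ?V \<times> ?V" and symE: "sym E" and n: "0 < n"
    using G by (auto simp: regular_graph_def)
  interpret machine ?inp n "input_size ?inp" by (rule machine_encode)
  define \<beta> where "\<beta> = 128 * real r * arv_cost ?V E r m x"
  have kV: "k \<le> card ?V" and TV: "real (card ?V) \<le> 2 * real (card (\<Union>i\<in>{1..2 * k}. T i))"
    using G(3) T(3) by simp_all
  obtain R b w u S where Rb: "(R, b) \<in> local_assignments ?V k" "w \<in> ?V" "u \<in> ?V"
    and S: "S = {v \<in> ?V. d R b v w + d R b w v \<le> d R b u w + d R b w u}" "S \<noteq> ?V"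
    and cut: "real (card (E \<inter> S \<times> (?V - S))) \<le> \<beta> / real (card ?V) * (real (card S) * real (card (?V - S)))"
    unfolding \<beta>_def by (rule sparse_sweep_cut_exists[OF G(1,2) kV sa T(1,2) TV])
  obtain l where l: "l < length L" "L ! l = (R, b)" using Rb(1) L by (metis in_set_conv_nth)
  have dist: "sweep_dist l w v = d R b v w + d R b w v" if "v < n" for v
    using rin_encode_dist[OF l, of _ n _ E r k m x d p] that Rb(2) unfolding sweep_dist_def nin_encode by simp
  have cand: "candidate l w u = small_side S"
    using dist Rb(3) unfolding candidate_def S(1) by (simp cong: conj_cong)
  let ?S = "small_side S"
  have SV: "S \<subseteq> ?V" "u \<in> S" using S(1) Rb(3) by auto
  then have fS: "finite S" "0 < card S" using finite_subset by (auto simp: card_gt_0_iff)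
  have cD: "card (?V - S) = n - card S" using SV(1) by (simp add: card_Diff_subset fS)
  have lt: "card S < n" using SV(1) S(2) psubset_card_mono[of ?V S] by auto
  have sS: "?S \<subseteq> ?V" "0 < card ?S" using SV fS lt cD by (auto simp: small_side_def)
  \<comment> \<open>By symmetry of \<open>E\<close>, a cut and its complement have equally many
    leaving edges, so passing to the smaller side is harmless.\<close>
  have swap: "card (E \<inter> (?V - S) \<times> S) = card (E \<inter> S \<times> (?V - S))"
  proof -
    have "E \<inter> (?V - S) \<times> S \<subseteq> prod.swap ` (E \<inter> S \<times> (?V - S))"
    proof
      fix e assume "e \<in> E \<inter> (?V - S) \<times> S"
      then have "prod.swap e \<in> E \<inter> S \<times> (?V - S)" using symD[OF symE] by (cases e) auto
      then have "prod.swap (prod.swap e) \<in> prod.swap ` (E \<inter> S \<times> (?V - S))" by (rule imageI)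
      then show "e \<in> prod.swap ` (E \<inter> S \<times> (?V - S))" by simp
    qed
    then have "E \<inter> (?V - S) \<times> S = prod.swap ` (E \<inter> S \<times> (?V - S))"
      using symD[OF symE] by auto
    then show ?thesis by (simp add: card_image)
  qed
  have "?V - (?V - S) = S" using SV(1) by blast
  then have "cut_size ?S = card (E \<inter> S \<times> (?V - S))"
    using swap SV(1) by (simp add: cut_size_encode[OF EV] small_side_def)
  then have "real (cut_size ?S) \<le> \<beta> / real n * (real (card S) * real (card (?V - S)))"
    using cut by simp
  \<comment> \<open>One of the two sides is \<open>?S\<close>, and the other has at most
    \<open>n\<close> vertices.\<close>
  also have "\<dots> \<le> \<beta> / real n * (real (card ?S) * real n)"
  proof (rule mult_left_mono)
    have "card S * card (?V - S) \<le> card ?S * n"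
      using lt by (auto simp: small_side_def cD intro: mult_le_mono)
    then show "real (card S) * real (card (?V - S)) \<le> real (card ?S) * real n"
      by (simp flip: of_nat_mult)
    show "0 \<le> \<beta> / real n"
      unfolding \<beta>_def arv_cost_def sqdist_def by (auto intro!: mult_nonneg_nonneg divide_nonneg_nonneg sum_nonneg)
  qed
  finally have cS: "real (cut_size ?S) \<le> \<beta> * real (card ?S)" using n by simp
  obtain s where s: "final_memory sweep_prog ?inp = return_pmf s"
    "best {candidate l w u | l w u. l < length L \<and> w < n \<and> u < n} s"
    by (rule sweep_prog_correct)
  let ?B = "output_set n s"
  have "candidate l w u \<in> {candidate l w u | l w u. l < length L \<and> w < n \<and> u < n}"
    using l Rb by blast
  then have le: "fst s (n + 15) * card ?S \<le> cut_size ?S * fst s (n + 16)"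
    using s(2) unfolding cand best_def by blast
  have B: "2 * card ?B \<le> n" "fst s (n + 16) = card ?B"
    "fst s (n + 15) = (if ?B = {} then 1 else cut_size ?B)"
    using s(2) unfolding best_def by blast+
  \<comment> \<open>With an empty output, variables 15 and 16 would be 1 and 0, and
    \<open>le\<close> would force the nonempty candidate \<open>?S\<close> to be empty.\<close>
  have ne: "?B \<noteq> {}" using le B sS(2) by auto
  have BV: "?B \<subseteq> ?V" by (auto simp: output_set_def)
  then have cB: "0 < card ?B" using ne finite_subset by (auto simp: card_gt_0_iff)
  have "real (cut_size ?B) * real (card ?S) \<le> real (cut_size ?S) * real (card ?B)"
    using le B ne by (simp flip: of_nat_mult)
  also have "\<dots> \<le> \<beta> * real (card ?S) * real (card ?B)" using cS by (rule mult_right_mono) simp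
  finally have "real (cut_size ?B) * real (card ?S) \<le> (\<beta> * real (card ?B)) * real (card ?S)"
    by (simp add: algebra_simps)
  then have "real (cut_size ?B) \<le> \<beta> * real (card ?B)" using sS(2) by simp
  then have "expansion ?V E r ?B \<le> 128 * arv_cost ?V E r m x"
    using G(2) cB by (simp add: expansion_def cut_size_encode[OF EV BV] \<beta>_def pos_divide_le_eq algebra_simps)
  with that s(1) cB B(1) show thesis by blast
qed

text \<open>The constants are \<open>c4 = 1 / 64\<close>, \<open>\<epsilon>1 = 1 / 2\<close> and
  \<open>C = 128\<close>.\<close>

theorem theorem3p4:
  shows "\<exists>(c4 :: real) (\<epsilon>1 :: real) (C :: real) (P :: com).
    c4 > 0 \<and> \<epsilon>1 > 0 \<and> C > 0 \<and> polynomial_time P rounding_inputs \<and>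
    (\<forall>(n :: nat) (E :: (nat \<times> nat) set) (r :: nat) (k :: nat)
        (L :: (nat set \<times> (nat \<Rightarrow> nat)) list) (m :: nat) (x :: nat \<Rightarrow> nat \<Rightarrow> real)
        (d :: nat set \<Rightarrow> (nat \<Rightarrow> nat) \<Rightarrow> nat \<Rightarrow> nat \<Rightarrow> real)
        (p :: nat set \<Rightarrow> (nat \<Rightarrow> nat) \<Rightarrow> real) (T :: nat \<Rightarrow> nat set).
      rounding_instance n E r k L \<and>
      sherali_adams_feasible {..<n} k m x d p \<and>
      (\<forall>i\<in>{1..2 * k}. T i \<subseteq> {..<n} \<and> diameter_of (sqdist m x) (T i) \<le> c4) \<and>
      real (card (\<Union>i\<in>{1..2 * k}. T i)) \<ge> (1 - \<epsilon>1) * real n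
      \<longrightarrow>
      measure_pmf.prob (final_memory P (encode n E r k L m x d p))
        {s. let S = output_set n s in
              0 < card S \<and> real (card S) \<le> real n / 2 \<and>
              expansion {..<n} E r S \<le> C * arv_cost {..<n} E r m x}
        \<ge> 1 - 1 / real n)"
proof (rule exI[of _ "1 / 64"], rule exI[of _ "1 / 2"], rule exI[of _ 128], rule exI[of _ sweep_prog],
    intro conjI allI impI polynomial_time_sweep_prog)
  fix n E r k L m x d p and T :: "nat \<Rightarrow> nat set"
  assume *: "rounding_instance n E r k L \<and> sherali_adams_feasible {..<n} k m x d p \<and>
    (\<forall>i\<in>{1..2 * k}. T i \<subseteq> {..<n} \<and> diameter_of (sqdist m x) (T i) \<le> 1 / 64) \<and>
    real (card (\<Union>i\<in>{1..2 * k}. T i)) \<ge> (1 - 1 / 2) * real n"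
  obtain s where s: "final_memory sweep_prog (encode n E r k L m x d p) = return_pmf s"
    "0 < card (output_set n s)" "2 * card (output_set n s) \<le> n"
    "expansion {..<n} E r (output_set n s) \<le> 128 * arv_cost {..<n} E r m x"
    by (rule sweep_prog_expansion[of n E r k L m x d p T]) (use * in auto)
  have "real (card (output_set n s)) \<le> real n / 2" using s(3) by linarith
  \<comment> \<open>The final memory is a point mass at \<open>s\<close>, so the probability is
    1.\<close>
  then show "measure_pmf.prob (final_memory sweep_prog (encode n E r k L m x d p))
      {s. let S = output_set n s in
            0 < card S \<and> real (card S) \<le> real n / 2 \<and>
            expansion {..<n} E r S \<le> 128 * arv_cost {..<n} E r m x} \<ge> 1 - 1 / real n"
    using s by (simp add: indicator_def)
qed auto

end
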